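(* Let $\mathcal{F}_1$ be the family of $K3$ surfaces parametrised by the complete anticanonical linear system of the toric Fano $3$-fold $\mathbb{P}_{\Delta_1}$, where $$\Delta_1=\mathrm{Conv}\{(-1,-1,1),(-1,1,-1),(3,-1,-1),(5,-1,-1),(-1,5,-1)\}.$$ The family $\mathcal{F}_1$ contains $K3$ surfaces that are double coverings of $\mathbb{P}^2$ branching along curves of $(2,3)$-torus type with singularities $$A_{17},\quad A_2+A_{14},\quad A_5+A_{11},\quad E_6+A_{11},\quad 2A_8,\quad 2A_2+A_{11},$$ $$A_2+A_5+A_8,\quad 3A_5,\quad 3A_2+A_8,\quad 2A_2+2A_5,\quad\text{and}\quad 4A_2+A_5.$$ That is, for each configuration in this list there is a curve $B=(F=0)$ of $(2,3)$-torus type with exactly this configuration of singularities such that the double covering $W^2-F(X,Y,Z)=0$ of $\mathbb{P}^2$ is a section in $\mathcal{F}_1$.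
   Context: Everything is over $\mathbb{C}$. A curve of $(2,3)$-torus type is a plane sextic curve in $\mathbb{P}^2$ (homogeneous coordinates $X,Y,Z$) defined by a polynomial $F=F_2^3+F_3^2$, with $F_i$ homogeneous of degree $i$, having at most simple (ADE) singularities. $A_n$ ($n\ge1$) denotes the plane curve singularity locally given by $x^2+y^{n+1}=0$ and $E_6$ the one locally given by $x^3+y^4=0$; a sum such as $2A_2+A_{11}$ lists all singular points of the curve with multiplicity. The double covering of $\mathbb{P}^2$ branched along $B=(F=0)$ is the Gorenstein $K3$ surface $W^2-F(X,Y,Z)=0$ in the weighted projective space $\mathbb{P}(1,1,1,3)$ with coordinates $X,Y,Z,W$ of weights $1,1,1,3$. A Gorenstein $K3$ surface (at most simple singularities, trivial canonical divisor, irregularity zero) is identified with the unique smooth $K3$ surface birational to it. Lattice points are identified with monomials of weighted degree $6$ by $$(a,b,c)\longleftrightarrow X^{a+1}\,Y^{b+1}\,Z^{1-a-b-3c}\,W^{c+1}.$$ For example $(-1,-1,1)\leftrightarrow W^2$, $(-1,1,-1)\leftrightarrow Y^2Z^4$, $(3,-1,-1)\leftrightarrow X^4Z^2$, $(5,-1,-1)\leftrightarrow X^6$, $(-1,5,-1)\leftrightarrow Y^6$. For a reflexive polytope $\Delta$, $\mathbb{P}_\Delta$ is the toric Fano $3$-fold whose fan consists of the cones over the faces of the polar dual $\Delta^*=\{y : \langle y,x\rangle\ge-1\ \forall x\in\Delta\}$; its anticanonical sections are the linear combinations of the monomials corresponding to the lattice points of $\Delta$. The surface $W^2-F=0$ is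 a section in the family when $W^2-F$ is such a linear combination. *)

theory Defs
  imports "HOL-Analysis.Analysis" "HOL-Library.Poly_Mapping" "HOL-Library.Multiset"
begin

section \<open>Ternary forms and points of the projective plane\<close>

text \<open>
  A polynomial in $X,Y,Z$ maps the exponent triple $(i,j,k)$ to the coefficient of
  $X^i Y^j Z^k$; the monoid of exponents is the product monoid, so the ring operations
  are those of \<^theory>\<open>HOL-Library.Poly_Mapping\<close>.
\<close>

type_synonym poly3 = "(nat \<times> nat \<times> nat) \<Rightarrow>\<^sub>0 complex"

definition eval3 :: "poly3 \<Rightarrow> complex \<Rightarrow> complex \<Rightarrow> complex \<Rightarrow> complex" where
  "eval3 F x y z = (\<Sum>(i, j, k)\<in>Poly_Mapping.keys F. Poly_Mapping.lookup F (i, j, k) * x ^ i * y ^ j * z ^ k)"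

definition homogeneous3 :: "nat \<Rightarrow> poly3 \<Rightarrow> bool" where
  "homogeneous3 d F \<longleftrightarrow> (\<forall>(i, j, k)\<in>Poly_Mapping.keys F. i + j + k = d)"

text \<open>A point $[x:y:z]$ is the set of its nonzero representatives.\<close>

type_synonym proj_point = "(complex \<times> complex \<times> complex) set"

definition ppoint :: "complex \<Rightarrow> complex \<Rightarrow> complex \<Rightarrow> proj_point" where
  "ppoint x y z = {(c * x, c * y, c * z) | c. c \<noteq> 0}"

text \<open>Jacobian criterion: $F$ and its three partial derivatives vanish.\<close>

definition singular_points :: "poly3 \<Rightarrow> proj_point set" where
  "singular_points F = {ppoint x y z | x y z.
     (x, y, z) \<noteq> (0, 0, 0) \<and> eval3 F x y z = 0 \<and>
     deriv (\<lambda>s. eval3 F s y z) x = 0 \<and>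
     deriv (\<lambda>s. eval3 F x s z) y = 0 \<and>
     deriv (\<lambda>s. eval3 F x y s) z = 0}"


section \<open>Germs of plane analytic curves and simple singularities\<close>

text \<open>
  Holomorphy in two variables: on an open set, the real Frechet derivative exists and is
  complex linear at every point.
\<close>

definition holomorphic2_on :: "(complex \<times> complex \<Rightarrow> complex) \<Rightarrow> (complex \<times> complex) set \<Rightarrow> bool" where
  "holomorphic2_on f U \<longleftrightarrow> open U \<and>
     (\<forall>p\<in>U. \<exists>a b. (f has_derivative (\<lambda>(h, k). a * h + b * k)) (at p))"

definition biholomorphism2 ::
  "(complex \<times> complex) set \<Rightarrow> (complex \<times> complex) set \<Rightarrow>
   (complex \<times> complex \<Rightarrow> complex \<times> complex) \<Rightarrow> (complex \<times> complex \<Rightarrow> complex \<times> complex) \<Rightarrow> bool" where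
  "biholomorphism2 U V \<phi> \<psi> \<longleftrightarrow>
     holomorphic2_on (fst \<circ> \<phi>) U \<and> holomorphic2_on (snd \<circ> \<phi>) U \<and>
     holomorphic2_on (fst \<circ> \<psi>) V \<and> holomorphic2_on (snd \<circ> \<psi>) V \<and>
     \<phi> ` U \<subseteq> V \<and> \<psi> ` V \<subseteq> U \<and>
     (\<forall>p\<in>U. \<psi> (\<phi> p) = p) \<and> (\<forall>q\<in>V. \<phi> (\<psi> q) = q)"

text \<open>
  The germs of $(f=0)$ at $p$ and of $(g=0)$ at $q$ are isomorphic: after a local
  biholomorphic change of coordinates the equations agree up to a unit. The unit compares
  the principal ideals and not just the zero sets, so multiple components are detected.
\<close>

definition curve_germ_iso ::
  "(complex \<times> complex \<Rightarrow> complex) \<Rightarrow> complex \<times> complex \<Rightarrow>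
   (complex \<times> complex \<Rightarrow> complex) \<Rightarrow> complex \<times> complex \<Rightarrow> bool" where
  "curve_germ_iso f p g q \<longleftrightarrow> (\<exists>U V \<phi> \<psi> u.
     p \<in> U \<and> q \<in> V \<and> biholomorphism2 U V \<phi> \<psi> \<and> \<phi> p = q \<and>
     holomorphic2_on u U \<and> (\<forall>r\<in>U. u r \<noteq> 0) \<and>
     (\<forall>r\<in>U. f r = u r * g (\<phi> r)))"

datatype ade = A nat | D nat | E6 | E7 | E8

fun valid_ade :: "ade \<Rightarrow> bool" where
  "valid_ade (A n) \<longleftrightarrow> n \<ge> 1"
| "valid_ade (D n) \<longleftrightarrow> n \<ge> 4"
| "valid_ade E6 \<longleftrightarrow> True"
| "valid_ade E7 \<longleftrightarrow> True"
| "valid_ade E8 \<longleftrightarrow> True"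

fun ade_equation :: "ade \<Rightarrow> complex \<times> complex \<Rightarrow> complex" where
  "ade_equation (A n) (x, y) = x ^ 2 + y ^ (n + 1)"
| "ade_equation (D n) (x, y) = x ^ 2 * y + y ^ (n - 1)"
| "ade_equation E6 (x, y) = x ^ 3 + y ^ 4"
| "ade_equation E7 (x, y) = x ^ 3 + x * y ^ 3"
| "ade_equation E8 (x, y) = x ^ 3 + y ^ 5"

text \<open>
  The germ of the curve $(F=0)$ at $P$ is taken in a standard affine chart containing $P$;
  its isomorphism class does not depend on the chart.
\<close>

definition has_singularity_type :: "poly3 \<Rightarrow> proj_point \<Rightarrow> ade \<Rightarrow> bool" where
  "has_singularity_type F P T \<longleftrightarrow> valid_ade T \<and>
     ((\<exists>x y. P = ppoint x y 1 \<and>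
        curve_germ_iso (\<lambda>(s, t). eval3 F s t 1) (x, y) (ade_equation T) (0, 0)) \<or>
      (\<exists>x z. P = ppoint x 1 z \<and>
        curve_germ_iso (\<lambda>(s, t). eval3 F s 1 t) (x, z) (ade_equation T) (0, 0)) \<or>
      (\<exists>y z. P = ppoint 1 y z \<and>
        curve_germ_iso (\<lambda>(s, t). eval3 F 1 s t) (y, z) (ade_equation T) (0, 0)))"

definition at_most_simple_singularities :: "poly3 \<Rightarrow> bool" where
  "at_most_simple_singularities F \<longleftrightarrow>
     (\<forall>P\<in>singular_points F. \<exists>T. has_singularity_type F P T)"

definition singularity_configuration :: "poly3 \<Rightarrow> ade multiset \<Rightarrow> bool" where
  "singularity_configuration F M \<longleftrightarrow> finite (singular_points F) \<and>
     (\<exists>\<tau>. (\<forall>P\<in>singular_points F. has_singularity_type F P (\<tau> P)) \<and>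
          M = image_mset \<tau> (mset_set (singular_points F)))"

definition torus_type_23 :: "poly3 \<Rightarrow> bool" where
  "torus_type_23 F \<longleftrightarrow> F \<noteq> 0 \<and>
     (\<exists>F\<^sub>2 F\<^sub>3. homogeneous3 2 F\<^sub>2 \<and> homogeneous3 3 F\<^sub>3 \<and> F = F\<^sub>2 ^ 3 + F\<^sub>3 ^ 2) \<and>
     at_most_simple_singularities F"


section \<open>Anticanonical sections\<close>

text \<open>Polynomials in $X,Y,Z,W$, with exponents listed in this order.\<close>

type_synonym poly4 = "(nat \<times> nat \<times> nat \<times> nat) \<Rightarrow>\<^sub>0 complex"

text \<open>The equation $W^2 - F(X,Y,Z)$ of the double covering of the plane branched along $(F=0)$.\<close>

definition double_cover :: "poly3 \<Rightarrow> poly4" where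
  "double_cover F = Poly_Mapping.single (0, 0, 0, 2) 1
     - (\<Sum>(i, j, k)\<in>Poly_Mapping.keys F. Poly_Mapping.single (i, j, k, 0) (Poly_Mapping.lookup F (i, j, k)))"

type_synonym real3 = "real \<times> real \<times> real"

text \<open>
  The lattice point $(a,b,c)$ corresponds to $X^{a+1} Y^{b+1} Z^{1-a-b-3c} W^{c+1}$.
\<close>

definition polytope_monomials :: "real3 set \<Rightarrow> (nat \<times> nat \<times> nat \<times> nat) set" where
  "polytope_monomials \<Delta> = {(i, j, k, l). \<exists>a b c :: int.
     (real_of_int a, real_of_int b, real_of_int c) \<in> \<Delta> \<and>
     int i = a + 1 \<and> int j = b + 1 \<and> int k = 1 - a - b - 3 * c \<and> int l = c + 1}"

definition anticanonical_sections :: "real3 set \<Rightarrow> poly4 set" where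
  "anticanonical_sections \<Delta> = {G. Poly_Mapping.keys G \<subseteq> polytope_monomials \<Delta>}"

definition lattice_polytope :: "real3 set \<Rightarrow> bool" where
  "lattice_polytope \<Delta> \<longleftrightarrow> (\<exists>S. finite S \<and> S \<subseteq> \<int> \<times> \<int> \<times> \<int> \<and> \<Delta> = convex hull S)"

definition polar_dual :: "real3 set \<Rightarrow> real3 set" where
  "polar_dual \<Delta> = {y. \<forall>x\<in>\<Delta>. y \<bullet> x \<ge> -1}"

definition reflexive_polytope :: "real3 set \<Rightarrow> bool" where
  "reflexive_polytope \<Delta> \<longleftrightarrow>
     lattice_polytope \<Delta> \<and> 0 \<in> interior \<Delta> \<and> lattice_polytope (polar_dual \<Delta>)"

definition \<Delta>\<^sub>1 :: "real3 set" where
  "\<Delta>\<^sub>1 = convex hull {(-1, -1, 1), (-1, 1, -1), (3, -1, -1), (5, -1, -1), (-1, 5, -1)}"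

lemma lattice_polytopeI:
  assumes "finite S" "S \<subseteq> \<int> \<times> \<int> \<times> \<int>" "\<Delta> = convex hull S"
  shows "lattice_polytope \<Delta>"
  using assms unfolding lattice_polytope_def by blast

lemma convex_comb5:
  fixes p q r s t :: real3
  assumes "a \<ge> 0" "b \<ge> 0" "c \<ge> 0" "d \<ge> 0" "e \<ge> 0" "a + b + c + d + e = 1"
    and "x = a *\<^sub>R p + b *\<^sub>R q + c *\<^sub>R r + d *\<^sub>R s + e *\<^sub>R t"
  shows "x \<in> convex hull {p, q, r, s, t}"
proof -
  let ?S = "{p, q, r, s, t}"
  let ?v = "[p, q, r, s, t]" and ?w = "[a, b, c, d, e]"
  have "(\<Sum>i\<in>{..<5::nat}. (?w ! i) *\<^sub>R (?v ! i)) \<in> convex hull ?S"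
  proof (rule convex_sum)
    show "convex (convex hull ?S)" by simp
    show "(\<Sum>i\<in>{..<5::nat}. ?w ! i) = 1"
      using assms by (simp add: eval_nat_numeral)
    fix i :: nat assume "i \<in> {..<5}"
    then have "i = 0 \<or> i = 1 \<or> i = 2 \<or> i = 3 \<or> i = 4" by auto
    then show "?w ! i \<ge> 0" "?v ! i \<in> convex hull ?S"
      using assms by (auto intro!: hull_inc)
  qed simp
  then show ?thesis
    using assms by (simp add: eval_nat_numeral add.assoc)
qed

lemma polar_dual_convex_hull:
  "polar_dual (convex hull S) = {y. \<forall>x\<in>S. y \<bullet> x \<ge> -1}"
proof (intro equalityI subsetI)
  fix y assume "y \<in> {y. \<forall>x\<in>S. y \<bullet> x \<ge> -1}"
  then have "S \<subseteq> {x. y \<bullet> x \<ge> -1}" by auto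
  then have "convex hull S \<subseteq> {x. y \<bullet> x \<ge> -1}"
    by (intro hull_minimal convex_halfspace_ge)
  then show "y \<in> polar_dual (convex hull S)" by (auto simp: polar_dual_def)
qed (auto simp: polar_dual_def hull_inc)

lemma polar_dual_\<Delta>\<^sub>1:
  "polar_dual \<Delta>\<^sub>1 = convex hull {(1, 0, 0), (0, 1, 0), (0, 0, 1), (-1, -1, -3), (1, 2, 2)}"
    (is "_ = convex hull ?T")
proof (intro equalityI subsetI)
  fix y assume "y \<in> convex hull ?T"
  moreover have "convex hull ?T \<subseteq> {y. \<forall>x\<in>{(-1, -1, 1), (-1, 1, -1), (3, -1, -1), (5, -1, -1), (-1, 5, -1)}. x \<bullet> y \<ge> -1}"
  proof (rule hull_minimal)
    show "convex {y. \<forall>x\<in>{(-1, -1, 1), (-1, 1, -1), (3, -1, -1), (5, -1, -1), (-1, 5, -1)}.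
        x \<bullet> y \<ge> (-1::real)}" (is "convex {y. \<forall>x\<in>?V. _ x y}")
    proof -
      have "{y. \<forall>x\<in>?V. x \<bullet> y \<ge> (-1::real)} = (\<Inter>x\<in>?V. {y. x \<bullet> y \<ge> -1})" by blast
      then show ?thesis by (simp only:) (intro convex_INT convex_halfspace_ge)
    qed
  qed auto
  ultimately show "y \<in> polar_dual \<Delta>\<^sub>1"
    unfolding \<Delta>\<^sub>1_def polar_dual_convex_hull by (auto simp: inner_commute)
next
  fix y assume y: "y \<in> polar_dual \<Delta>\<^sub>1"
  obtain a b c where abc: "y = (a, b, c)" by (cases y)
  have h: "-a - b + c \<ge> -1" "-a + b - c \<ge> -1" "3*a - b - c \<ge> -1" "5*a - b - c \<ge> -1"
    "-a + 5*b - c \<ge> -1"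
    using y unfolding \<Delta>\<^sub>1_def polar_dual_convex_hull abc by auto
  define d where "d = (1 - a - b + c) / 2"
  show "y \<in> convex hull ?T"
  proof (cases "c \<le> d")
    case True
    define e where "e = (d - c) / 3"
    show ?thesis
      by (rule convex_comb5[where a = "a + e" and b = "b + e" and c = d and d = e and e = 0])
        (use h True in \<open>auto simp: abc d_def e_def field_simps\<close>)
  next
    case False
    define e where "e = (c - d) / 2"
    show ?thesis
      by (rule convex_comb5[where a = "a - e" and b = "b - 2 * e" and c = d and d = 0 and e = e])
        (use h False in \<open>auto simp: abc d_def e_def field_simps\<close>)
  qed
qed

text \<open>So $\mathbb{P}_{\Delta_1}$ is indeed a toric Fano threefold.\<close>

lemma reflexive_\<Delta>\<^sub>1: "reflexive_polytope \<Delta>\<^sub>1"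
  unfolding reflexive_polytope_def
proof (intro conjI)
  show "lattice_polytope \<Delta>\<^sub>1"
    by (rule lattice_polytopeI[OF _ _ \<Delta>\<^sub>1_def]) auto
  show "lattice_polytope (polar_dual \<Delta>\<^sub>1)"
    by (rule lattice_polytopeI[OF _ _ polar_dual_\<Delta>\<^sub>1]) auto
  define U where "U = {x :: real3. fst x > -1 \<and> snd (snd x) > -1 \<and>
    1 + fst x + 2 * fst (snd x) + 2 * snd (snd x) > 0 \<and>
    1 - 3 * fst x - 2 * fst (snd x) - 6 * snd (snd x) > 0}"
  have "open U"
    unfolding U_def by (intro open_Collect_conj open_Collect_less continuous_intros)
  moreover have "0 \<in> U" by (simp add: U_def)
  moreover have "U \<subseteq> \<Delta>\<^sub>1"
  proof
    fix x assume "x \<in> U"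
    then obtain a b c where x: "x = (a, b, c)" and
      h: "a > -1" "c > -1" "1 + a + 2 * b + 2 * c > 0" "1 - 3 * a - 2 * b - 6 * c > 0"
      by (cases x) (auto simp: U_def)
    show "x \<in> \<Delta>\<^sub>1"
      unfolding \<Delta>\<^sub>1_def
      by (rule convex_comb5[where a = "(c + 1) / 2" and b = "(1 - 3 * a - 2 * b - 6 * c) / 8"
            and c = "(a + 1) / 4" and d = 0 and e = "(1 + a + 2 * b + 2 * c) / 8"])
        (use h in \<open>auto simp: x field_simps\<close>)
  qed
  ultimately show "0 \<in> interior \<Delta>\<^sub>1" by (meson interiorI)
qed

end

theory Submission imports Defs "HOL-Complex_Analysis.Complex_Analysis" begin

text \<open>
  Each curve is $F = F_2^3 + F_3^2$ with $F_2$ and $F_3$ chosen so that $F_2$ is very simple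
  (a double line, two lines, or a smooth conic) and all base points $F_2 = F_3 = 0$ have small
  integer coordinates. Where $F_3$ is smooth and meets $F_2 = 0$ with multiplicity $m$, write
  $F_2 = e s^m + h F_3$ in local coordinates $(s, F_3)$; completing the square gives $A_{3m-1}$.
  The point $E_6$ arises where $F_3$ has a double point. Taking $[0:0:1]$ as a base
  point where $F_3$ is tangent to $Y = 0$ and $F_2$ is tangent to it or singular puts the
  monomials of $F$ into $\Delta_1$. A singular point off the base locus would be a solution of
  $3 w \nabla F_2 = 2 \nabla F_3$, $F_2 = -w^2 \neq 0$, and these equations are inconsistent.
\<close>

section \<open>Holomorphic germs in two variables\<close>

text \<open>
  Holomorphy near $p$ with gradient $(a,b)$ at $p$. Continuity of the partial derivatives
  follows from complex differentiability, but building it in makes the inverse function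
  theorem applicable without Osgood's lemma.
\<close>

definition hol2 :: "(complex \<times> complex \<Rightarrow> complex) \<Rightarrow> complex \<times> complex \<Rightarrow> complex \<Rightarrow> complex \<Rightarrow> bool" where
  "hol2 f p a b \<longleftrightarrow> (\<exists>U f1 f2. open U \<and> p \<in> U \<and> continuous_on U f1 \<and> continuous_on U f2 \<and>
     (\<forall>q\<in>U. (f has_derivative (\<lambda>(h, k). f1 q * h + f2 q * k)) (at q)) \<and> f1 p = a \<and> f2 p = b)"

lemma hol2E:
  assumes "hol2 f p a b"
  obtains U f1 f2 where "open U" "p \<in> U" "continuous_on U f" "continuous_on U f1" "continuous_on U f2"
    "\<And>q. q \<in> U \<Longrightarrow> (f has_derivative (\<lambda>(h, k). f1 q * h + f2 q * k)) (at q)"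
    "f1 p = a" "f2 p = b"
proof -
  from assms obtain U f1 f2 where U: "open U" "p \<in> U" "continuous_on U f1" "continuous_on U f2"
    "\<And>q. q \<in> U \<Longrightarrow> (f has_derivative (\<lambda>(h, k). f1 q * h + f2 q * k)) (at q)"
    "f1 p = a" "f2 p = b"
    unfolding hol2_def by blast
  then have "continuous_on U f"
    by (meson continuous_at_imp_continuous_on has_derivative_continuous)
  with U that show thesis by blast
qed

lemma hol2_const: "hol2 (\<lambda>q. c) p 0 0"
  unfolding hol2_def
  by (rule exI[of _ UNIV], rule exI[of _ "\<lambda>_. 0"], rule exI[of _ "\<lambda>_. 0"]) (auto intro!: derivative_eq_intros)

lemma hol2_fst: "hol2 fst p 1 0"
  unfolding hol2_def
  by (rule exI[of _ UNIV], rule exI[of _ "\<lambda>_. 1"], rule exI[of _ "\<lambda>_. 0"]) (auto intro!: derivative_eq_intros)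

lemma hol2_snd: "hol2 snd p 0 1"
  unfolding hol2_def
  by (rule exI[of _ UNIV], rule exI[of _ "\<lambda>_. 0"], rule exI[of _ "\<lambda>_. 1"]) (auto intro!: derivative_eq_intros)

lemma hol2_add:
  assumes "hol2 f p a b" "hol2 g p c d"
  shows "hol2 (\<lambda>q. f q + g q) p (a + c) (b + d)"
proof -
  obtain U f1 f2 where U: "open U" "p \<in> U" "continuous_on U f1" "continuous_on U f2"
    "\<And>q. q \<in> U \<Longrightarrow> (f has_derivative (\<lambda>(h, k). f1 q * h + f2 q * k)) (at q)" "f1 p = a" "f2 p = b"
    using assms(1) by (rule hol2E) (rule that)
  obtain V g1 g2 where V: "open V" "p \<in> V" "continuous_on V g1" "continuous_on V g2"
    "\<And>q. q \<in> V \<Longrightarrow> (g has_derivative (\<lambda>(h, k). g1 q * h + g2 q * k)) (at q)" "g1 p = c" "g2 p = d"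
    using assms(2) by (rule hol2E) (rule that)
  show ?thesis
    unfolding hol2_def
  proof (intro exI conjI ballI)
    fix q assume "q \<in> U \<inter> V"
    then show "((\<lambda>q. f q + g q) has_derivative (\<lambda>(h, k). (f1 q + g1 q) * h + (f2 q + g2 q) * k)) (at q)"
      by (auto intro!: has_derivative_eq_rhs[OF has_derivative_add[OF U(5) V(5)]] simp: algebra_simps)
  qed (use U V in \<open>auto intro!: continuous_intros intro: continuous_on_subset\<close>)
qed

lemma hol2_mult:
  assumes "hol2 f p a b" "hol2 g p c d"
  shows "hol2 (\<lambda>q. f q * g q) p (f p * c + a * g p) (f p * d + b * g p)"
proof -
  obtain U f1 f2 where U: "open U" "p \<in> U" "continuous_on U f" "continuous_on U f1" "continuous_on U f2"
    "\<And>q. q \<in> U \<Longrightarrow> (f has_derivative (\<lambda>(h, k). f1 q * h + f2 q * k)) (at q)" "f1 p = a" "f2 p = b"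
    using assms(1) by (rule hol2E) (rule that)
  obtain V g1 g2 where V: "open V" "p \<in> V" "continuous_on V g" "continuous_on V g1" "continuous_on V g2"
    "\<And>q. q \<in> V \<Longrightarrow> (g has_derivative (\<lambda>(h, k). g1 q * h + g2 q * k)) (at q)" "g1 p = c" "g2 p = d"
    using assms(2) by (rule hol2E) (rule that)
  show ?thesis
    unfolding hol2_def
  proof (intro exI conjI ballI)
    fix q assume "q \<in> U \<inter> V"
    then show "((\<lambda>q. f q * g q) has_derivative
        (\<lambda>(h, k). (f q * g1 q + f1 q * g q) * h + (f q * g2 q + f2 q * g q) * k)) (at q)"
      by (auto intro!: has_derivative_eq_rhs[OF has_derivative_mult[OF U(6) V(6)]] simp: algebra_simps)
  qed (use U V in \<open>auto intro!: continuous_intros intro: continuous_on_subset\<close>)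
qed

lemma hol2_compose:
  assumes "hol2 f p a b" "g holomorphic_on S" "open S" "f p \<in> S"
  shows "hol2 (\<lambda>q. g (f q)) p (deriv g (f p) * a) (deriv g (f p) * b)"
proof -
  obtain U f1 f2 where U: "open U" "p \<in> U" "continuous_on U f" "continuous_on U f1" "continuous_on U f2"
    "\<And>q. q \<in> U \<Longrightarrow> (f has_derivative (\<lambda>(h, k). f1 q * h + f2 q * k)) (at q)" "f1 p = a" "f2 p = b"
    using assms(1) by (rule hol2E) (rule that)
  define V where "V = U \<inter> f -` S"
  have V: "open V" "p \<in> V" "V \<subseteq> U"
    using continuous_open_preimage[OF U(3,1) assms(3)] U(2) assms(4) by (auto simp: V_def)
  have "continuous_on S (deriv g)"
    by (intro holomorphic_on_imp_continuous_on holomorphic_deriv assms)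
  then have dc: "continuous_on V (\<lambda>q. deriv g (f q))"
    by (rule continuous_on_compose2) (use U(3) V_def in \<open>auto intro: continuous_on_subset\<close>)
  show ?thesis
    unfolding hol2_def
  proof (intro exI conjI ballI)
    fix q assume q: "q \<in> V"
    have "(g has_field_derivative deriv g (f q)) (at (f q))"
      using q assms by (auto simp: V_def intro!: holomorphic_derivI)
    then have "((\<lambda>q. g (f q)) has_derivative (\<lambda>h. deriv g (f q) * (case h of (h, k) \<Rightarrow> f1 q * h + f2 q * k))) (at q)"
      using q V by (intro has_derivative_compose[OF U(6)]) (auto simp: has_field_derivative_def)
    then show "((\<lambda>q. g (f q)) has_derivative (\<lambda>(h, k). (deriv g (f q) * f1 q) * h + (deriv g (f q) * f2 q) * k)) (at q)"
      by (rule has_derivative_eq_rhs) (auto simp: algebra_simps)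
  qed (use U V dc in \<open>auto intro!: continuous_intros intro: continuous_on_subset\<close>)
qed

lemma hol2_power:
  assumes "hol2 f p a b"
  shows "hol2 (\<lambda>q. f q ^ n) p (of_nat n * f p ^ (n - 1) * a) (of_nat n * f p ^ (n - 1) * b)"
proof -
  have "deriv (\<lambda>z::complex. z ^ n) (f p) = of_nat n * f p ^ (n - 1)"
    by (rule DERIV_imp_deriv) (auto intro!: derivative_eq_intros)
  with hol2_compose[OF assms, of "\<lambda>z. z ^ n" UNIV] show ?thesis
    by (simp add: holomorphic_intros)
qed

lemma hol2_minus: "hol2 f p a b \<Longrightarrow> hol2 (\<lambda>q. - f q) p (- a) (- b)"
  using hol2_mult[OF hol2_const[of "-1"]] by simp

lemma hol2_diff: "hol2 f p a b \<Longrightarrow> hol2 g p c d \<Longrightarrow> hol2 (\<lambda>q. f q - g q) p (a - c) (b - d)"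
  using hol2_add[OF _ hol2_minus] by fastforce

lemmas hol2_intros = hol2_const hol2_fst hol2_snd hol2_add hol2_diff hol2_minus hol2_mult hol2_power

lemma hol2_divide:
  assumes "hol2 f p a b" "hol2 g p c d" "g p \<noteq> 0"
  obtains a' b' where "hol2 (\<lambda>q. f q / g q) p a' b'"
proof -
  have "inverse holomorphic_on - {0 :: complex}"
    by (auto intro!: holomorphic_intros)
  from hol2_mult[OF assms(1) hol2_compose[OF assms(2) this]] assms(3) that show thesis
    by (auto simp: divide_inverse)
qed

lemma hol2_nth_root:
  assumes "hol2 f p a b" "f p \<noteq> 0" "n > 0"
  obtains r c d where "hol2 r p c d" "r p \<noteq> 0" "\<forall>\<^sub>F q in nhds p. r q ^ n = f q"
proof -
  obtain z where z: "z ^ n = f p"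
    using assms(3) by (metis exists_complex_root neq0_conv)
  define S where "S = {w. w / f p \<notin> \<real>\<^sub>\<le>\<^sub>0}"
  define g where "g = (\<lambda>w. z * exp (Ln (w / f p) / of_nat n))"
  have "S = (\<lambda>w. w / f p) -` (- \<real>\<^sub>\<le>\<^sub>0)" by (auto simp: S_def)
  moreover have "open ((\<lambda>w. w / f p) -` (- \<real>\<^sub>\<le>\<^sub>0 :: complex set))"
    using assms(2) by (intro open_vimage continuous_intros) (auto simp: open_Compl)
  ultimately have S: "open S" by simp
  have p: "f p \<in> S" using assms(2) by (simp add: S_def)
  have "g holomorphic_on S"
    unfolding g_def S_def using assms(2,3) by (auto intro!: holomorphic_intros)
  note h = hol2_compose[OF assms(1) this S p]
  have "g w ^ n = w" if "w \<in> S" for w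
  proof -
    have "w / f p \<noteq> 0" using that by (auto simp: S_def)
    then show ?thesis
      using assms z by (simp add: g_def power_mult_distrib flip: exp_of_nat_mult)
  qed
  moreover have "\<forall>\<^sub>F q in nhds p. f q \<in> S"
  proof -
    obtain U where U: "open U" "p \<in> U" "continuous_on U f"
      using assms(1) by (rule hol2E) (rule that)
    have "\<forall>\<^sub>F q in nhds p. q \<in> U \<inter> f -` S"
      using continuous_open_preimage[OF U(3,1) S] U(2) p by (intro eventually_nhds_in_open) auto
    then show ?thesis by eventually_elim auto
  qed
  ultimately have "\<forall>\<^sub>F q in nhds p. g (f q) ^ n = f q" by (auto elim: eventually_mono)
  moreover have "g (f p) \<noteq> 0"
    using z assms by (auto simp: g_def zero_power)
  ultimately show thesis using that h by blast
qed

lemma complex_linear2_inverse: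
  fixes a b c d :: complex
  assumes "a * d - b * c \<noteq> 0"
  shows "bij (\<lambda>(h, k). (a * h + b * k, c * h + d * k))"
    and "inv (\<lambda>(h, k). (a * h + b * k, c * h + d * k)) =
    (\<lambda>(h, k). (d / (a * d - b * c) * h + (- b / (a * d - b * c)) * k,
               (- c / (a * d - b * c)) * h + a / (a * d - b * c) * k))"
    (is "inv ?f = ?g")
proof -
  define e where "e = a * d - b * c"
  have e: "e \<noteq> 0" "a * d = e + b * c" using assms by (auto simp: e_def)
  have "?f \<circ> ?g = id" "?g \<circ> ?f = id"
    unfolding e_def[symmetric] using e by (auto simp: fun_eq_iff field_simps)
  then show "bij ?f" "inv ?f = ?g"
    by (auto intro: o_bij inv_unique_comp)
qed

lemma local_biholomorphism2:
  assumes X: "hol2 X p a b" and Y: "hol2 Y p c d" and det: "a * d - b * c \<noteq> 0"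
    and W: "\<forall>\<^sub>F q in nhds p. q \<in> W"
  obtains U V \<psi> where "p \<in> U" "U \<subseteq> W" "(X p, Y p) \<in> V" "biholomorphism2 U V (\<lambda>q. (X q, Y q)) \<psi>"
proof -
  obtain U1 X1 X2 where U1: "open U1" "p \<in> U1" "continuous_on U1 X" "continuous_on U1 X1" "continuous_on U1 X2"
    "\<And>q. q \<in> U1 \<Longrightarrow> (X has_derivative (\<lambda>(h, k). X1 q * h + X2 q * k)) (at q)" "X1 p = a" "X2 p = b"
    using X by (rule hol2E) (rule that)
  obtain U2 Y1 Y2 where U2: "open U2" "p \<in> U2" "continuous_on U2 Y" "continuous_on U2 Y1" "continuous_on U2 Y2"
    "\<And>q. q \<in> U2 \<Longrightarrow> (Y has_derivative (\<lambda>(h, k). Y1 q * h + Y2 q * k)) (at q)" "Y1 p = c" "Y2 p = d"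
    using Y by (rule hol2E) (rule that)
  obtain W' where W': "open W'" "p \<in> W'" "W' \<subseteq> W"
    using W unfolding eventually_nhds subset_iff by blast
  define \<Omega> where "\<Omega> = U1 \<inter> U2 \<inter> W'"
  define \<delta> where "\<delta> q = X1 q * Y2 q - X2 q * Y1 q" for q
  define U where "U = \<Omega> \<inter> \<delta> -` (- {0})"
  have cont: "continuous_on \<Omega> X1" "continuous_on \<Omega> X2" "continuous_on \<Omega> Y1" "continuous_on \<Omega> Y2"
    using U1(4,5) U2(4,5) by (auto simp: \<Omega>_def intro: continuous_on_subset)
  have "continuous_on \<Omega> \<delta>"
    unfolding \<delta>_def by (intro continuous_intros cont)
  moreover have "open \<Omega>" using U1(1) U2(1) W'(1) by (auto simp: \<Omega>_def)
  ultimately have "open U"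
    unfolding U_def by (intro continuous_open_preimage) auto
  have "p \<in> U" using U1(2,7,8) U2(2,7,8) W'(2) det by (auto simp: U_def \<Omega>_def \<delta>_def)
  define \<phi> where "\<phi> q = (X q, Y q)" for q
  define D where "D q = Blinfun (\<lambda>(h, k). (X1 q * h + X2 q * k, Y1 q * h + Y2 q * k))" for q
  have bl: "bounded_linear (\<lambda>(h, k). (s * h + t * k, u * h + v * k))" for s t u v :: complex
    by (auto simp: case_prod_beta' intro!: bounded_linear_intros)
  have D: "blinfun_apply (D q) = (\<lambda>(h, k). (X1 q * h + X2 q * k, Y1 q * h + Y2 q * k))" for q
    unfolding D_def by (rule bounded_linear_Blinfun_apply[OF bl])
  have der: "(\<phi> has_derivative blinfun_apply (D q)) (at q)" if "q \<in> U" for q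
  proof -
    have "q \<in> U1" "q \<in> U2" using that by (auto simp: U_def \<Omega>_def)
    from has_derivative_Pair[OF U1(6)[OF this(1)] U2(6)[OF this(2)]]
    show ?thesis unfolding \<phi>_def D by (simp add: case_prod_beta')
  qed
  have contD: "continuous_on U D"
  proof (rule continuous_on_blinfun_componentwise)
    fix i :: "complex \<times> complex"
    have "continuous_on U X1" "continuous_on U X2" "continuous_on U Y1" "continuous_on U Y2"
      using cont by (auto simp: U_def intro: continuous_on_subset)
    then show "continuous_on U (\<lambda>x. blinfun_apply (D x) i)"
      unfolding D by (cases i) (auto intro!: continuous_intros)
  qed
  have inj: "\<delta> q \<noteq> 0" if "q \<in> U" for q using that by (auto simp: U_def)
  define I where "I q = (\<lambda>(h, k). (Y2 q / \<delta> q * h + (- X2 q / \<delta> q) * k, (- Y1 q / \<delta> q) * h + X1 q / \<delta> q * k))" for q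
  have I: "inv (blinfun_apply (D q)) = I q" if "q \<in> U" for q
    unfolding D I_def \<delta>_def using inj[OF that] by (intro complex_linear2_inverse(2)) (simp add: \<delta>_def)
  have bi: "bij (blinfun_apply (D q))" if "q \<in> U" for q
    unfolding D using inj[OF that] by (intro complex_linear2_inverse(1)) (simp add: \<delta>_def)
  have invf: "Blinfun (I p) o\<^sub>L D p = id_blinfun"
  proof (rule blinfun_eqI)
    fix i
    have "blinfun_apply (Blinfun (I p)) = I p"
      unfolding I_def by (rule bounded_linear_Blinfun_apply[OF bl])
    then show "blinfun_apply (Blinfun (I p) o\<^sub>L D p) i = blinfun_apply id_blinfun i"
      using bi[OF \<open>p \<in> U\<close>] by (simp add: bij_is_inj flip: I[OF \<open>p \<in> U\<close>])
  qed
  obtain U' V g g' where g: "open U'" "U' \<subseteq> U" "p \<in> U'" "open V" "\<phi> p \<in> V" "homeomorphism U' V \<phi> g"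
    "\<And>y. y \<in> V \<Longrightarrow> (g has_derivative g' y) (at y)"
    "\<And>y. y \<in> V \<Longrightarrow> g' y = inv (blinfun_apply (D (g y)))"
    by (rule inverse_function_theorem[OF \<open>open U\<close> der contD \<open>p \<in> U\<close> invf]) (assumption, rule that)
  have hom: "\<phi> ` U' = V" "g ` V = U'" "\<forall>q\<in>U'. g (\<phi> q) = q" "\<forall>q\<in>V. \<phi> (g q) = q"
    using g(6) by (auto simp: homeomorphism_def)
  have dg: "(g has_derivative I (g y)) (at y)" if "y \<in> V" for y
  proof -
    have "g y \<in> U" using hom(2) g(2) that by blast
    then show ?thesis using g(7,8)[OF that] I by simp
  qed
  have "holomorphic2_on (fst \<circ> g) V"
    unfolding holomorphic2_on_def
  proof (intro conjI ballI exI)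
    fix y assume "y \<in> V"
    from has_derivative_fst[OF dg[OF this]]
    show "(fst \<circ> g has_derivative (\<lambda>(h, k). (Y2 (g y) / \<delta> (g y)) * h + (- X2 (g y) / \<delta> (g y)) * k)) (at y)"
      by (simp add: I_def case_prod_beta' o_def)
  qed (use g in auto)
  moreover have "holomorphic2_on (snd \<circ> g) V"
    unfolding holomorphic2_on_def
  proof (intro conjI ballI exI)
    fix y assume "y \<in> V"
    from has_derivative_snd[OF dg[OF this]]
    show "(snd \<circ> g has_derivative (\<lambda>(h, k). (- Y1 (g y) / \<delta> (g y)) * h + (X1 (g y) / \<delta> (g y)) * k)) (at y)"
      by (simp add: I_def case_prod_beta' o_def)
  qed (use g in auto)
  moreover have "holomorphic2_on (fst \<circ> \<phi>) U'" "holomorphic2_on (snd \<circ> \<phi>) U'"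
    unfolding holomorphic2_on_def \<phi>_def comp_def fst_conv snd_conv
    using U1(6) U2(6) g(1,2) unfolding U_def \<Omega>_def by blast+
  ultimately have "biholomorphism2 U' V (\<lambda>q. (X q, Y q)) g"
    using hom by (auto simp: biholomorphism2_def \<phi>_def[abs_def])
  with g(2,3,5) W'(3) show thesis
    by (intro that[of U' V]) (auto simp: U_def \<Omega>_def \<phi>_def)
qed

lemma biholomorphic_coordinates_germ_iso:
  assumes X: "hol2 X p a b" and Y: "hol2 Y p c d" and det: "a * d - b * c \<noteq> 0"
    and "X p = 0" "Y p = 0" and f: "\<forall>\<^sub>F q in nhds p. f q = g (X q, Y q)"
  shows "curve_germ_iso f p g (0, 0)"
proof -
  obtain U V \<psi> where "p \<in> U" "U \<subseteq> {q. f q = g (X q, Y q)}" "(X p, Y p) \<in> V"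
    "biholomorphism2 U V (\<lambda>q. (X q, Y q)) \<psi>"
    by (rule local_biholomorphism2[OF X Y det, of "{q. f q = g (X q, Y q)}"]) (use f in simp, rule that)
  moreover from this(4) have "holomorphic2_on (\<lambda>_. 1) U"
    by (auto simp: biholomorphism2_def holomorphic2_on_def intro!: exI[of _ 0] derivative_eq_intros)
  ultimately show ?thesis
    using assms(4,5) unfolding curve_germ_iso_def
    by (intro exI[of _ U] exI[of _ V] exI[of _ "\<lambda>q. (X q, Y q)"] exI[of _ \<psi>] exI[of _ "\<lambda>_. 1"]) auto
qed

text \<open>The units are absorbed by rescaling $u$ and $s$ with local roots of $\alpha$ and $\beta$.\<close>

lemma brieskorn_germ_iso:
  assumes u: "hol2 u p u1 u2" and s: "hol2 s p s1 s2" and det: "u1 * s2 - u2 * s1 \<noteq> 0"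
    and "u p = 0" "s p = 0"
    and \<alpha>: "hol2 \<alpha> p \<alpha>1 \<alpha>2" "\<alpha> p \<noteq> 0" and \<beta>: "hol2 \<beta> p \<beta>1 \<beta>2" "\<beta> p \<noteq> 0"
    and "k > 0" "n > 0"
    and f: "\<forall>\<^sub>F q in nhds p. f q = \<alpha> q * u q ^ k + \<beta> q * s q ^ n"
    and g: "\<And>x y. g (x, y) = x ^ k + y ^ n"
  shows "curve_germ_iso f p g (0, 0)"
proof -
  obtain r c d where r: "hol2 r p c d" "r p \<noteq> 0" "\<forall>\<^sub>F q in nhds p. r q ^ k = \<alpha> q"
    by (rule hol2_nth_root[OF \<alpha> \<open>k > 0\<close>]) (rule that)
  obtain t e l where t: "hol2 t p e l" "t p \<noteq> 0" "\<forall>\<^sub>F q in nhds p. t q ^ n = \<beta> q"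
    by (rule hol2_nth_root[OF \<beta> \<open>n > 0\<close>]) (rule that)
  show ?thesis
  proof (rule biholomorphic_coordinates_germ_iso[OF hol2_mult[OF r(1) u] hol2_mult[OF t(1) s]])
    have "(r p * u1) * (t p * s2) - (r p * u2) * (t p * s1) = r p * t p * (u1 * s2 - u2 * s1)"
      by (simp add: algebra_simps)
    then show "(r p * u1 + c * u p) * (t p * s2 + l * s p) - (r p * u2 + d * u p) * (t p * s1 + e * s p) \<noteq> 0"
      using assms(4,5) det r(2) t(2) by simp
    show "\<forall>\<^sub>F q in nhds p. f q = g (r q * u q, t q * s q)"
      using f r(3) t(3) by eventually_elim (simp add: g power_mult_distrib)
  qed (use assms(4,5) in auto)
qed

lemma hol2_eventually_nonzero:
  assumes "hol2 f p a b" "f p \<noteq> 0"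
  shows "\<forall>\<^sub>F q in nhds p. f q \<noteq> 0"
proof -
  obtain U where U: "open U" "p \<in> U" "continuous_on U f"
    using assms(1) by (rule hol2E) (rule that)
  have "\<forall>\<^sub>F q in nhds p. q \<in> U \<inter> f -` (- {0})"
    using continuous_open_preimage[OF U(3,1)] U(2) assms(2) by (intro eventually_nhds_in_open) auto
  then show ?thesis by eventually_elim auto
qed

text \<open>
  For $u = e s^m + h v$ the expansion of $u^3 + v^2$ is quadratic in $v$ up to the unit
  $\alpha = 1 + 3 e h^2 s^m + h^3 v$; completing the square turns it into
  $\alpha w^2 + \beta s^{3m}$.
\<close>

lemma torus_germ_iso:
  assumes v: "hol2 v p v1 v2" and s: "hol2 s p s1 s2" and det: "v1 * s2 - v2 * s1 \<noteq> 0"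
    and vp: "v p = 0" and sp: "s p = 0"
    and q: "hol2 q p q1 q2" "q p \<noteq> 0" and e: "hol2 e p e1 e2" "e p \<noteq> 0" and h: "hol2 h p h1 h2"
    and "m > 0" and u: "\<And>x. q x * u x = e x * s x ^ m + h x * v x"
  shows "curve_germ_iso (\<lambda>x. u x ^ 3 + v x ^ 2) p (ade_equation (A (3 * m - 1))) (0, 0)"
proof -
  obtain e1' e2' where e': "hol2 (\<lambda>x. e x / q x) p e1' e2'"
    by (rule hol2_divide[OF e(1) q]) (rule that)
  obtain h1' h2' where h': "hol2 (\<lambda>x. h x / q x) p h1' h2'"
    by (rule hol2_divide[OF h q]) (rule that)
  define E where "E x = e x / q x" for x
  define H where "H x = h x / q x" for x
  define \<alpha> where "\<alpha> x = 1 + (3 * (E x * H x ^ 2) * s x ^ m + H x ^ 3 * v x)" for x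
  define K where "K x = 3 * (E x ^ 2 * H x) / (2 * \<alpha> x)" for x
  define \<beta> where "\<beta> x = E x ^ 3 - \<alpha> x * K x ^ 2 * s x ^ m" for x
  have E: "hol2 E p e1' e2'" and H: "hol2 H p h1' h2'"
    using e' h' by (simp_all add: E_def[abs_def] H_def[abs_def])
  have \<alpha>p: "\<alpha> p = 1" using vp sp \<open>m > 0\<close> by (simp add: \<alpha>_def)
  have "\<exists>a b. hol2 \<alpha> p a b"
    unfolding \<alpha>_def[abs_def]
    by (intro exI, (rule hol2_add hol2_mult hol2_power hol2_const E H s v)+)
  then obtain \<alpha>1 \<alpha>2 where \<alpha>: "hol2 \<alpha> p \<alpha>1 \<alpha>2" by blast
  note num = hol2_mult[OF hol2_const[of 3] hol2_mult[OF hol2_power[OF E] H]]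
  obtain k1 k2 where "hol2 (\<lambda>x. 3 * (E x ^ 2 * H x) / (2 * \<alpha> x)) p k1 k2"
    by (rule hol2_divide[OF num hol2_mult[OF hol2_const[of 2] \<alpha>]]) (simp add: \<alpha>p, rule that)
  then have K: "hol2 K p k1 k2"
    by (simp add: K_def[abs_def])
  have "\<exists>a b. hol2 \<beta> p a b"
    unfolding \<beta>_def[abs_def]
    by (intro exI, (rule hol2_diff hol2_mult hol2_power hol2_const E \<alpha> K s)+)
  then obtain \<beta>1 \<beta>2 where \<beta>: "hol2 \<beta> p \<beta>1 \<beta>2" by blast
  have \<beta>p: "\<beta> p \<noteq> 0" using e q sp \<open>m > 0\<close> by (simp add: \<beta>_def E_def zero_power)
  have w: "hol2 (\<lambda>x. v x + K x * s x ^ (2 * m)) p v1 v2"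
  proof -
    have "0 ^ (2 * m - 1) = (0 :: complex)" using \<open>m > 0\<close> by simp
    with hol2_add[OF v hol2_mult[OF K hol2_power[OF s, of "2 * m"]]] show ?thesis
      using sp \<open>m > 0\<close> by (simp add: zero_power)
  qed
  show ?thesis
  proof (rule brieskorn_germ_iso[OF w s det _ sp \<alpha> _ \<beta> \<beta>p, of 2 "3 * m"])
    have "\<forall>\<^sub>F x in nhds p. q x \<noteq> 0" "\<forall>\<^sub>F x in nhds p. \<alpha> x \<noteq> 0"
      using hol2_eventually_nonzero[OF q] hol2_eventually_nonzero[OF \<alpha>] \<alpha>p by auto
    then show "\<forall>\<^sub>F x in nhds p. u x ^ 3 + (v x)\<^sup>2
        = \<alpha> x * (v x + K x * s x ^ (2 * m))\<^sup>2 + \<beta> x * s x ^ (3 * m)"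
    proof eventually_elim
      case (elim x)
      define S where "S = s x ^ m"
      have "s x ^ (3 * m) = S ^ 3" "s x ^ (2 * m) = S ^ 2"
        by (simp_all add: S_def mult.commute flip: power_mult)
      then have "\<alpha> x * (v x + K x * s x ^ (2 * m))\<^sup>2 + \<beta> x * s x ^ (3 * m) =
          \<alpha> x * v x ^ 2 + (2 * \<alpha> x * K x) * (S ^ 2 * v x) + E x ^ 3 * S ^ 3"
        unfolding \<beta>_def S_def[symmetric]
        by (simp add: power2_eq_square power3_eq_cube algebra_simps)
      also have "2 * \<alpha> x * K x = 3 * (E x ^ 2 * H x)"
        using elim(2) by (simp add: K_def)
      also have "\<alpha> x * v x ^ 2 + 3 * (E x ^ 2 * H x) * (S ^ 2 * v x) + E x ^ 3 * S ^ 3 =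
          (E x * S + H x * v x) ^ 3 + v x ^ 2"
        unfolding \<alpha>_def S_def[symmetric]
        by (simp add: power2_eq_square power3_eq_cube algebra_simps)
      also have "E x * S + H x * v x = u x"
        using u[of x] elim(1) by (simp add: E_def H_def S_def field_simps)
      finally show ?case ..
    qed
  qed (use vp sp \<alpha>p \<open>m > 0\<close> in auto)
qed

section \<open>Ternary forms and the polytope\<close>

lemma eval3_superset:
  assumes "finite S" "Poly_Mapping.keys F \<subseteq> S"
  shows "eval3 F x y z = (\<Sum>(i, j, k)\<in>S. Poly_Mapping.lookup F (i, j, k) * x ^ i * y ^ j * z ^ k)"
  unfolding eval3_def using assms
  by (intro sum.mono_neutral_left) (auto simp: in_keys_iff)

lemma eval3_zero [simp]: "eval3 0 x y z = 0"
  by (simp add: eval3_def)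

lemma eval3_add [simp]: "eval3 (F + G) x y z = eval3 F x y z + eval3 G x y z"
proof -
  let ?S = "Poly_Mapping.keys F \<union> Poly_Mapping.keys G"
  have "Poly_Mapping.keys (F + G) \<subseteq> ?S" by (rule Poly_Mapping.keys_add)
  then show ?thesis
    by (simp add: eval3_superset[of ?S] lookup_add case_prod_beta' algebra_simps sum.distrib)
qed

lemma eval3_single [simp]:
  "eval3 (Poly_Mapping.single (i, j, k) c) x y z = c * x ^ i * y ^ j * z ^ k"
  by (subst eval3_superset[of "{(i, j, k)}"]) auto

lemma eval3_sum: "eval3 (\<Sum>i\<in>I. F i) x y z = (\<Sum>i\<in>I. eval3 (F i) x y z)"
  by (induction I rule: infinite_finite_induct) auto

lemma sum_singles: "(\<Sum>t\<in>Poly_Mapping.keys F. Poly_Mapping.single t (Poly_Mapping.lookup F t)) = F"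
  for F :: "'a \<Rightarrow>\<^sub>0 'b::comm_monoid_add"
  by (rule poly_mapping_eqI) (auto simp: lookup_sum lookup_single when_def in_keys_iff)

lemma eval3_mult [simp]: "eval3 (F * G) x y z = eval3 F x y z * eval3 G x y z"
proof -
  have *: "eval3 (Poly_Mapping.single s a * Poly_Mapping.single t b) x y z =
      eval3 (Poly_Mapping.single s a) x y z * eval3 (Poly_Mapping.single t b) x y z" for s t a b
    by (cases s; cases t) (simp add: mult_single power_add)
  have "F * G = (\<Sum>s\<in>Poly_Mapping.keys F. \<Sum>t\<in>Poly_Mapping.keys G.
      Poly_Mapping.single s (Poly_Mapping.lookup F s) * Poly_Mapping.single t (Poly_Mapping.lookup G t))"
    by (simp flip: sum_product add: sum_singles)
  then have "eval3 (F * G) x y z =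
      eval3 (\<Sum>t\<in>Poly_Mapping.keys F. Poly_Mapping.single t (Poly_Mapping.lookup F t)) x y z *
      eval3 (\<Sum>t\<in>Poly_Mapping.keys G. Poly_Mapping.single t (Poly_Mapping.lookup G t)) x y z"
    by (simp add: eval3_sum * sum_product)
  then show ?thesis by (simp only: sum_singles)
qed

lemma eval3_power [simp]: "eval3 (F ^ n) x y z = eval3 F x y z ^ n"
proof (induction n)
  case 0
  have "eval3 (Poly_Mapping.single (0, 0, 0) 1) x y z = 1" by simp
  then show ?case by (simp add: zero_prod_def[symmetric])
qed simp

text \<open>
  The monomials of $\Delta_1$ free of $W$ are the sextic ones with $i + 2 j \ge 4$: giving
  $x$ weight 1 and $y$ weight 2, the affine equation at $[0:0:1]$ has order at least 4.
\<close>

definition form_of_order :: "nat \<Rightarrow> nat \<Rightarrow> poly3 \<Rightarrow> bool" where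
  "form_of_order d w F \<longleftrightarrow> (\<forall>(i, j, k)\<in>Poly_Mapping.keys F. i + j + k = d \<and> w \<le> i + 2 * j)"

lemma form_of_order_add:
  "form_of_order d w F \<Longrightarrow> form_of_order d w G \<Longrightarrow> form_of_order d w (F + G)"
  unfolding form_of_order_def
proof
  fix t assume *: "\<forall>(i, j, k)\<in>Poly_Mapping.keys F. i + j + k = d \<and> w \<le> i + 2 * j"
    "\<forall>(i, j, k)\<in>Poly_Mapping.keys G. i + j + k = d \<and> w \<le> i + 2 * j"
    and "t \<in> Poly_Mapping.keys (F + G)"
  then have "t \<in> Poly_Mapping.keys F \<or> t \<in> Poly_Mapping.keys G"
    using Poly_Mapping.keys_add[of F G] by blast
  with * show "case t of (i, j, k) \<Rightarrow> i + j + k = d \<and> w \<le> i + 2 * j"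
    by (elim disjE) (drule (1) bspec, assumption)+
qed

lemma form_of_order_single:
  "i + j + k = d \<Longrightarrow> w \<le> i + 2 * j \<Longrightarrow> form_of_order d w (Poly_Mapping.single (i, j, k) c)"
  by (auto simp: form_of_order_def)

lemma form_of_order_mult:
  assumes "form_of_order d w F" "form_of_order d' w' G"
  shows "form_of_order (d + d') (w + w') (F * G)"
  unfolding form_of_order_def
proof
  fix t assume "t \<in> Poly_Mapping.keys (F * G)"
  then obtain r s where "r \<in> Poly_Mapping.keys F" "s \<in> Poly_Mapping.keys G" "t = r + s"
    using keys_mult[of F G] by blast
  with assms show "case t of (i, j, k) \<Rightarrow> i + j + k = d + d' \<and> w + w' \<le> i + 2 * j"
    unfolding form_of_order_def by (cases r; cases s) (auto dest!: bspec)
qed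

lemma form_of_order_mono: "form_of_order d w F \<Longrightarrow> w' \<le> w \<Longrightarrow> form_of_order d w' F"
  unfolding form_of_order_def by (auto dest!: bspec)

lemma sextic_monomial_in_polytope:
  assumes "i + j + k = 6" "4 \<le> i + 2 * j"
  shows "(i, j, k, 0) \<in> polytope_monomials \<Delta>\<^sub>1"
proof -
  have "(real i - 1, real j - 1, -1) \<in> \<Delta>\<^sub>1"
  proof (cases "j \<le> 2")
    case True
    define t where "t = (real i + 2 * real j - 4) / (real j + 2)"
    have ij: "real i + 2 * real j \<ge> 4" "real i + real j \<le> 6" "real j \<le> 2"
      using assms True by linarith+
    then have "0 \<le> t" "t \<le> 1" by (auto simp: t_def)
    have t: "t * (real j + 2) = real i + 2 * real j - 4" by (simp add: t_def)
    show ?thesis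
      unfolding \<Delta>\<^sub>1_def
    proof (rule convex_comb5)
      show "0 \<le> (0::real)" "0 \<le> (1 - t) * (real j / 2)" "0 \<le> (1 - t) * (1 - real j / 2)"
        "0 \<le> t * (1 - real j / 6)" "0 \<le> t * (real j / 6)"
        using \<open>0 \<le> t\<close> \<open>t \<le> 1\<close> ij by auto
    qed (use t in \<open>auto simp: field_simps\<close>)
  next
    case False
    define t where "t = real i / (6 - real j)"
    have ij: "real i + real j \<le> 6" "real j \<ge> 2"
      using assms False by linarith+
    then have "0 \<le> t" "t \<le> 1" by (auto simp: t_def divide_le_eq_1)
    have t: "t * (6 - real j) = real i" using assms by (cases "j = 6") (auto simp: t_def)
    show ?thesis
      unfolding \<Delta>\<^sub>1_def
    proof (rule convex_comb5)
      show "0 \<le> (0::real)" "0 \<le> (1 - t) * ((6 - real j) / 4)" "0 \<le> (0::real)"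
        "0 \<le> t * (1 - real j / 6)" "0 \<le> (1 - t) * ((real j - 2) / 4) + t * (real j / 6)"
        using \<open>0 \<le> t\<close> \<open>t \<le> 1\<close> ij by auto
    qed (use t in \<open>auto simp: field_simps\<close>)
  qed
  then show ?thesis
    using assms unfolding polytope_monomials_def
    by (intro CollectI case_prodI exI[of _ "int i - 1"] exI[of _ "int j - 1"] exI[of _ "-1::int"]) auto
qed

lemma double_cover_anticanonical:
  assumes "form_of_order 6 4 F"
  shows "double_cover F \<in> anticanonical_sections \<Delta>\<^sub>1"
proof -
  have W: "(0, 0, 0, 2) \<in> polytope_monomials \<Delta>\<^sub>1"
    unfolding polytope_monomials_def \<Delta>\<^sub>1_def
    by (intro CollectI case_prodI exI[of _ "-1::int"] exI[of _ "1::int"] conjI hull_inc) auto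
  have "Poly_Mapping.keys (\<Sum>(i, j, k)\<in>Poly_Mapping.keys F.
      Poly_Mapping.single (i, j, k, 0::nat) (Poly_Mapping.lookup F (i, j, k))) \<subseteq> polytope_monomials \<Delta>\<^sub>1"
    (is "Poly_Mapping.keys ?S \<subseteq> _")
  proof (rule order_trans[OF keys_sum], rule UN_least)
    fix t assume t: "t \<in> Poly_Mapping.keys F"
    obtain i j k where ijk: "t = (i, j, k)" by (cases t)
    have "(i, j, k, 0) \<in> polytope_monomials \<Delta>\<^sub>1"
      using assms t ijk by (intro sextic_monomial_in_polytope) (auto simp: form_of_order_def)
    then show "Poly_Mapping.keys (case t of (i, j, k) \<Rightarrow>
        Poly_Mapping.single (i, j, k, 0::nat) (Poly_Mapping.lookup F (i, j, k))) \<subseteq> polytope_monomials \<Delta>\<^sub>1"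
      by (auto simp: ijk)
  qed
  then show ?thesis
    using W keys_diff[of "Poly_Mapping.single (0, 0, 0, 2) 1" ?S]
    unfolding anticanonical_sections_def double_cover_def by (auto split: if_splits)
qed

lemma ppoint_eq_iff:
  assumes "(x, y, z) \<noteq> (0, 0, 0)" "(x', y', z') \<noteq> (0, 0, 0)"
  shows "ppoint x y z = ppoint x' y' z' \<longleftrightarrow> x * y' = x' * y \<and> x * z' = x' * z \<and> y * z' = y' * z"
proof
  assume "ppoint x y z = ppoint x' y' z'"
  moreover have "(x, y, z) \<in> ppoint x y z"
    unfolding ppoint_def by (auto intro!: exI[of _ 1])
  ultimately show "x * y' = x' * y \<and> x * z' = x' * z \<and> y * z' = y' * z"
    by (auto simp: ppoint_def)
next
  assume h: "x * y' = x' * y \<and> x * z' = x' * z \<and> y * z' = y' * z"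
  obtain c where c: "c \<noteq> 0" "x' = c * x" "y' = c * y" "z' = c * z"
  proof -
    consider "x \<noteq> 0" | "x = 0" "y \<noteq> 0" | "x = 0" "y = 0" "z \<noteq> 0" using assms(1) by auto
    then show thesis
    proof cases
      case 1
      then show thesis
        using h assms(2) by (intro that[of "x' / x"]) (auto simp: field_simps)
    next
      case 2
      then show thesis
        using h assms(2) by (intro that[of "y' / y"]) (auto simp: field_simps)
    next
      case 3
      then show thesis
        using h assms(2) by (intro that[of "z' / z"]) (auto simp: field_simps)
    qed
  qed
  show "ppoint x y z = ppoint x' y' z'"
  proof (intro equalityI subsetI)
    fix t assume "t \<in> ppoint x y z"
    then obtain d where "d \<noteq> 0" "t = (d * x, d * y, d * z)" unfolding ppoint_def by blast
    with c show "t \<in> ppoint x' y' z'"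
      unfolding ppoint_def by (intro CollectI exI[of _ "d / c"]) auto
  next
    fix t assume "t \<in> ppoint x' y' z'"
    then obtain d where "d \<noteq> 0" "t = (d * x', d * y', d * z')" unfolding ppoint_def by blast
    with c show "t \<in> ppoint x y z"
      unfolding ppoint_def by (intro CollectI exI[of _ "d * c"]) auto
  qed
qed

lemma singularity_configurationI:
  assumes "singular_points F = set (map fst L)" "distinct (map fst L)"
    and "\<And>P T. (P, T) \<in> set L \<Longrightarrow> has_singularity_type F P T"
    and "M = mset (map snd L)"
  shows "singularity_configuration F M"
proof -
  define \<tau> where "\<tau> P = the (map_of L P)" for P
  have \<tau>: "\<tau> P = T" if "(P, T) \<in> set L" for P T
    using that assms(2) by (simp add: \<tau>_def)
  have "mset_set (singular_points F) = mset (map fst L)"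
    using assms(1,2) by (simp only: mset_set_set)
  then have "image_mset \<tau> (mset_set (singular_points F)) = mset (map (\<lambda>p. \<tau> (fst p)) L)"
    by (simp add: o_def flip: mset_map)
  also have "map (\<lambda>p. \<tau> (fst p)) L = map snd L"
    using \<tau> by (intro map_cong) auto
  finally have "M = image_mset \<tau> (mset_set (singular_points F))"
    by (simp add: assms(4))
  moreover have "\<forall>P\<in>singular_points F. has_singularity_type F P (\<tau> P)"
    unfolding assms(1) using assms(3) \<tau> by auto
  ultimately show ?thesis
    unfolding singularity_configuration_def assms(1) by blast
qed

lemma singularity_configuration_imp_simple:
  "singularity_configuration F M \<Longrightarrow> at_most_simple_singularities F"
  unfolding singularity_configuration_def at_most_simple_singularities_def by blast

section \<open>Sextics of torus type\<close>

text \<open>All forms of degree 2, and all of degree 3 without $XYZ$ and monic in $Y Z^2$, of weighted order at least 2.\<close>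

definition conic_form :: "complex \<Rightarrow> complex \<Rightarrow> complex \<Rightarrow> complex \<Rightarrow> poly3" where
  "conic_form a b c d = Poly_Mapping.single (2, 0, 0) a + Poly_Mapping.single (1, 1, 0) b
     + Poly_Mapping.single (0, 2, 0) c + Poly_Mapping.single (0, 1, 1) d"

definition cubic_form :: "complex \<Rightarrow> complex \<Rightarrow> complex \<Rightarrow> complex \<Rightarrow> complex \<Rightarrow> complex \<Rightarrow> poly3" where
  "cubic_form e f g h k l = Poly_Mapping.single (3, 0, 0) e + Poly_Mapping.single (2, 1, 0) f
     + Poly_Mapping.single (1, 2, 0) g + Poly_Mapping.single (0, 3, 0) h
     + Poly_Mapping.single (2, 0, 1) k + Poly_Mapping.single (0, 2, 1) l
     + Poly_Mapping.single (0, 1, 2) 1"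

lemma eval3_conic: "eval3 (conic_form a b c d) x y z = a * x\<^sup>2 + b * x * y + c * y\<^sup>2 + d * y * z"
  by (simp add: conic_form_def)

lemma eval3_cubic: "eval3 (cubic_form e f g h k l) x y z =
    e * x ^ 3 + f * x\<^sup>2 * y + g * x * y\<^sup>2 + h * y ^ 3 + k * x\<^sup>2 * z + l * y\<^sup>2 * z + y * z\<^sup>2"
  by (simp add: cubic_form_def)

lemma form_of_order_conic: "form_of_order 2 2 (conic_form a b c d)"
  unfolding conic_form_def by (intro form_of_order_add form_of_order_single) auto

lemma form_of_order_cubic: "form_of_order 3 2 (cubic_form e f g h k l)"
  unfolding cubic_form_def by (intro form_of_order_add form_of_order_single) auto

lemma form_of_order_imp_homogeneous: "form_of_order d w F \<Longrightarrow> homogeneous3 d F"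
  by (auto simp: form_of_order_def homogeneous3_def)

text \<open>
  At a singular point off the base locus put $w = F_3 / F_2$; then $F_2 = -w^2$, $F_3 = -w^3$,
  and the vanishing of the gradient of $F_2^3 + F_3^2$ becomes $3 w \nabla F_2 = 2 \nabla F_3$.
\<close>

lemma torus_critical_values:
  fixes u v :: complex
  assumes "u ^ 3 + v\<^sup>2 = 0" "u \<noteq> 0"
  obtains w where "w \<noteq> 0" "u = - w\<^sup>2" "v = - (w ^ 3)"
    "\<And>u' v'. 3 * u\<^sup>2 * u' + 2 * v * v' = 0 \<longleftrightarrow> 3 * w * u' = 2 * v'"
proof
  define w where "w = v / u"
  have v: "v = w * u" using assms(2) by (simp add: w_def)
  have "u\<^sup>2 * (u + w\<^sup>2) = 0"
    using assms(1) unfolding v by (simp add: algebra_simps power2_eq_square power3_eq_cube)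
  with assms(2) show u: "u = - w\<^sup>2" by (simp add: eq_neg_iff_add_eq_0)
  with assms(2) show w: "w \<noteq> 0" by auto
  show v': "v = - (w ^ 3)" using u v by (simp add: power2_eq_square power3_eq_cube)
  fix u' v'
  have "3 * u\<^sup>2 * u' + 2 * v * v' = w ^ 3 * (3 * w * u' - 2 * v')"
    unfolding u v' by (simp add: algebra_simps power2_eq_square power3_eq_cube)
  then show "3 * u\<^sup>2 * u' + 2 * v * v' = 0 \<longleftrightarrow> 3 * w * u' = 2 * v'" using w by simp
qed

lemma torus_sextic_witness:
  fixes a b c d e f g h k l :: complex and L :: "((complex \<times> complex \<times> complex) \<times> ade) list"
  defines "Q \<equiv> \<lambda>x y z. a * x\<^sup>2 + b * x * y + c * y\<^sup>2 + d * y * z"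
    and "C \<equiv> \<lambda>x y z. e * x ^ 3 + f * x\<^sup>2 * y + g * x * y\<^sup>2 + h * y ^ 3 + k * x\<^sup>2 * z + l * y\<^sup>2 * z + y * z\<^sup>2"
  assumes outer: "\<And>x y z w. Q x y z = - w\<^sup>2 \<Longrightarrow>
      3 * w * (2 * a * x + b * y) = 2 * (3 * e * x\<^sup>2 + 2 * f * x * y + g * y\<^sup>2 + 2 * k * x * z) \<Longrightarrow>
      3 * w * (b * x + 2 * c * y + d * z)
        = 2 * (f * x\<^sup>2 + 2 * g * x * y + 3 * h * y\<^sup>2 + 2 * l * y * z + z\<^sup>2) \<Longrightarrow>
      3 * w * (d * y) = 2 * (k * x\<^sup>2 + l * y\<^sup>2 + 2 * y * z) \<Longrightarrow> w = 0"
    and inner: "\<And>x y z. (x, y, z) \<noteq> (0, 0, 0) \<Longrightarrow> Q x y z = 0 \<Longrightarrow> C x y z = 0 \<Longrightarrow>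
      ppoint x y z \<in> set (map (\<lambda>((x, y, z), T). ppoint x y z) L)"
    and points: "\<And>x y z T. ((x, y, z), T) \<in> set L \<Longrightarrow> (x, y, z) \<noteq> (0, 0, 0) \<and> Q x y z = 0 \<and> C x y z = 0"
    and types: "\<And>F x y z T. (\<And>x y z. eval3 F x y z = Q x y z ^ 3 + (C x y z)\<^sup>2) \<Longrightarrow>
      ((x, y, z), T) \<in> set L \<Longrightarrow> has_singularity_type F (ppoint x y z) T"
    and dist: "distinct (map (\<lambda>((x, y, z), T). ppoint x y z) L)"
    and M: "M = mset (map snd L)"
  shows "\<exists>F. torus_type_23 F \<and> singularity_configuration F M \<and>
    double_cover F \<in> anticanonical_sections \<Delta>\<^sub>1"
proof -
  define F where "F = conic_form a b c d ^ 3 + cubic_form e f g h k l ^ 2"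
  have eval: "eval3 F x y z = Q x y z ^ 3 + (C x y z)\<^sup>2" for x y z
    by (simp add: F_def eval3_conic eval3_cubic Q_def C_def)
  have dx: "deriv (\<lambda>s. eval3 F s y z) x = 3 * (Q x y z)\<^sup>2 * (2 * a * x + b * y)
      + 2 * C x y z * (3 * e * x\<^sup>2 + 2 * f * x * y + g * y\<^sup>2 + 2 * k * x * z)" for x y z
    unfolding eval Q_def C_def by (rule DERIV_imp_deriv, auto intro!: derivative_eq_intros, algebra)
  have dy: "deriv (\<lambda>s. eval3 F x s z) y = 3 * (Q x y z)\<^sup>2 * (b * x + 2 * c * y + d * z)
      + 2 * C x y z * (f * x\<^sup>2 + 2 * g * x * y + 3 * h * y\<^sup>2 + 2 * l * y * z + z\<^sup>2)" for x y z
    unfolding eval Q_def C_def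
    by (rule DERIV_imp_deriv, auto intro!: derivative_eq_intros, algebra)
  have dz: "deriv (\<lambda>s. eval3 F x y s) z = 3 * (Q x y z)\<^sup>2 * (d * y)
      + 2 * C x y z * (k * x\<^sup>2 + l * y\<^sup>2 + 2 * y * z)" for x y z
    unfolding eval Q_def C_def by (rule DERIV_imp_deriv, auto intro!: derivative_eq_intros, algebra)
  have base: "Q x y z = 0 \<and> C x y z = 0"
    if sing: "eval3 F x y z = 0" "deriv (\<lambda>s. eval3 F s y z) x = 0" "deriv (\<lambda>s. eval3 F x s z) y = 0"
      "deriv (\<lambda>s. eval3 F x y s) z = 0" for x y z
  proof (cases "Q x y z = 0")
    case True
    then show ?thesis using sing(1) by (simp add: eval)
  next
    case False
    obtain w where "w \<noteq> 0" "Q x y z = - w\<^sup>2" "C x y z = - (w ^ 3)"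
      "\<And>u' v'. 3 * (Q x y z)\<^sup>2 * u' + 2 * C x y z * v' = 0 \<longleftrightarrow> 3 * w * u' = 2 * v'"
      by (rule torus_critical_values[OF sing(1)[unfolded eval] False]) (rule that)
    then show ?thesis using outer[of x y z w] sing(2-4) unfolding dx dy dz by simp
  qed
  define pts where "pts = map (\<lambda>((x, y, z), T). (ppoint x y z, T)) L"
  have pts: "map fst pts = map (\<lambda>((x, y, z), T). ppoint x y z) L" "map snd pts = map snd L"
    by (auto simp: pts_def case_prod_beta')
  have sing: "singular_points F = set (map fst pts)"
  proof (intro equalityI subsetI)
    fix P assume "P \<in> singular_points F"
    then show "P \<in> set (map fst pts)"
      unfolding singular_points_def pts using base inner by blast
  next
    fix P assume "P \<in> set (map fst pts)"
    then obtain x y z T where P: "P = ppoint x y z" "((x, y, z), T) \<in> set L"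
      unfolding pts by auto
    from points[OF P(2)] show "P \<in> singular_points F"
      unfolding singular_points_def dx dy dz P(1)
      by - (rule CollectI, rule exI[of _ x], rule exI[of _ y], rule exI[of _ z], simp add: eval)
  qed
  have conf: "singularity_configuration F M"
  proof (rule singularity_configurationI[OF sing])
    show "distinct (map fst pts)" "M = mset (map snd pts)"
      using dist M by (simp_all only: pts)
    fix P T assume "(P, T) \<in> set pts"
    then show "has_singularity_type F P T"
      unfolding pts_def using types[OF eval] by auto
  qed
  have "F \<noteq> 0"
  proof
    assume "F = 0"
    then have *: "(c + d * z) ^ 3 + (h + l * z + z\<^sup>2)\<^sup>2 = 0" for z
      using eval[of 0 1 z] by (simp add: Q_def C_def)
    have "24 = ((c + d * 2) ^ 3 + (h + l * 2 + 2\<^sup>2)\<^sup>2) - 4 * ((c + d * 1) ^ 3 + (h + l * 1 + 1\<^sup>2)\<^sup>2)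
      + 6 * ((c + d * 0) ^ 3 + (h + l * 0 + 0\<^sup>2)\<^sup>2) - 4 * ((c + d * (-1)) ^ 3 + (h + l * (-1) + (-1)\<^sup>2)\<^sup>2)
      + ((c + d * (-2)) ^ 3 + (h + l * (-2) + (-2)\<^sup>2)\<^sup>2)"
      by (simp add: power2_eq_square power3_eq_cube algebra_simps)
    then show False unfolding * by simp
  qed
  then have "torus_type_23 F"
    unfolding torus_type_23_def
    using singularity_configuration_imp_simple[OF conf] F_def
      form_of_order_imp_homogeneous[OF form_of_order_conic] form_of_order_imp_homogeneous[OF form_of_order_cubic]
    by blast
  moreover have "form_of_order 6 4 F"
  proof -
    have "form_of_order 6 6 (conic_form a b c d ^ 3)"
      using form_of_order_mult[OF form_of_order_conic form_of_order_mult[OF form_of_order_conic form_of_order_conic]]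
      by (simp add: power3_eq_cube mult.assoc)
    moreover have "form_of_order 6 4 (cubic_form e f g h k l ^ 2)"
      using form_of_order_mult[OF form_of_order_cubic form_of_order_cubic] by (simp add: power2_eq_square)
    ultimately show ?thesis
      unfolding F_def by (intro form_of_order_add) (auto intro: form_of_order_mono)
  qed
  ultimately show ?thesis using conf double_cover_anticanonical by blast
qed

lemma torus_type_z:
  assumes "\<And>x y z. eval3 F x y z = Q x y z ^ 3 + (C x y z)\<^sup>2"
    and "hol2 (\<lambda>p. C (fst p) (snd p) 1) (x, y) v1 v2" "hol2 s (x, y) s1 s2"
    and "hol2 q (x, y) q1 q2" "hol2 e (x, y) e1 e2" "hol2 h (x, y) h1 h2"
    and "v1 * s2 - v2 * s1 \<noteq> 0" "C x y 1 = 0" "s (x, y) = 0" "q (x, y) \<noteq> 0" "e (x, y) \<noteq> 0"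
    and "\<And>p. q p * Q (fst p) (snd p) 1 = e p * s p ^ m + h p * C (fst p) (snd p) 1"
    and "n + 1 = 3 * m"
  shows "has_singularity_type F (ppoint x y 1) (A n)"
proof -
  have "n = 3 * m - 1" "m > 0" using assms(13) by auto
  have "curve_germ_iso (\<lambda>p. Q (fst p) (snd p) 1 ^ 3 + (C (fst p) (snd p) 1)\<^sup>2) (x, y) (ade_equation (A n)) (0, 0)"
    unfolding \<open>n = 3 * m - 1\<close> using assms(8)
    by (intro torus_germ_iso[OF assms(2,3,7) _ assms(9,4,10,5,11,6) \<open>m > 0\<close> assms(12)]) simp
  with \<open>n = 3 * m - 1\<close> \<open>m > 0\<close> show ?thesis
    unfolding has_singularity_type_def assms(1) case_prod_beta' by auto
qed

lemma torus_type_y: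
  assumes "\<And>x y z. eval3 F x y z = Q x y z ^ 3 + (C x y z)\<^sup>2"
    and "hol2 (\<lambda>p. C (fst p) 1 (snd p)) (x, z) v1 v2" "hol2 s (x, z) s1 s2"
    and "hol2 q (x, z) q1 q2" "hol2 e (x, z) e1 e2" "hol2 h (x, z) h1 h2"
    and "v1 * s2 - v2 * s1 \<noteq> 0" "C x 1 z = 0" "s (x, z) = 0" "q (x, z) \<noteq> 0" "e (x, z) \<noteq> 0"
    and "\<And>p. q p * Q (fst p) 1 (snd p) = e p * s p ^ m + h p * C (fst p) 1 (snd p)"
    and "n + 1 = 3 * m"
  shows "has_singularity_type F (ppoint x 1 z) (A n)"
proof -
  have "n = 3 * m - 1" "m > 0" using assms(13) by auto
  have "curve_germ_iso (\<lambda>p. Q (fst p) 1 (snd p) ^ 3 + (C (fst p) 1 (snd p))\<^sup>2) (x, z) (ade_equation (A n)) (0, 0)"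
    unfolding \<open>n = 3 * m - 1\<close> using assms(8)
    by (intro torus_germ_iso[OF assms(2,3,7) _ assms(9,4,10,5,11,6) \<open>m > 0\<close> assms(12)]) simp
  with \<open>n = 3 * m - 1\<close> \<open>m > 0\<close> show ?thesis
    unfolding has_singularity_type_def assms(1) case_prod_beta' by auto
qed

lemma torus_transversal_type_z:
  assumes eval: "\<And>x y z. eval3 F x y z = Q x y z ^ 3 + (C x y z)\<^sup>2"
    and C: "hol2 (\<lambda>p. C (fst p) (snd p) 1) (x, y) v1 v2" and Q: "hol2 (\<lambda>p. Q (fst p) (snd p) 1) (x, y) u1 u2"
    and "v1 * u2 - v2 * u1 \<noteq> 0" "C x y 1 = 0" "Q x y 1 = 0"
  shows "has_singularity_type F (ppoint x y 1) (A 2)"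
  by (rule torus_type_z[OF eval C Q hol2_const[of 1] hol2_const[of 1] hol2_const[of 0], where m = 1])
    (use assms in auto)

lemma torus_transversal_type_y:
  assumes eval: "\<And>x y z. eval3 F x y z = Q x y z ^ 3 + (C x y z)\<^sup>2"
    and C: "hol2 (\<lambda>p. C (fst p) 1 (snd p)) (x, z) v1 v2" and Q: "hol2 (\<lambda>p. Q (fst p) 1 (snd p)) (x, z) u1 u2"
    and "v1 * u2 - v2 * u1 \<noteq> 0" "C x 1 z = 0" "Q x 1 z = 0"
  shows "has_singularity_type F (ppoint x 1 z) (A 2)"
  by (rule torus_type_y[OF eval C Q hol2_const[of 1] hol2_const[of 1] hol2_const[of 0], where m = 1])
    (use assms in auto)

section \<open>The eleven curves\<close>

lemma torus_sextic_A17: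
  "\<exists>F. torus_type_23 F \<and> singularity_configuration F {#A 17#} \<and>
    double_cover F \<in> anticanonical_sections \<Delta>\<^sub>1"
proof (rule torus_sextic_witness[where a = 0 and b = 0 and c = 1 and d = 0 and
      e = 1 and f = 0 and g = 0 and h = 0 and k = 0 and l = 0 and
      L = "[((0, 0, 1), A 17)]"],
    goal_cases outer inner points types dist mset)
  case (outer x y z w)
  then have "w ^ 6 = 0" by algebra
  then show ?case by simp
next
  case (inner x y z)
  then have "y = 0" "x = 0" by simp_all
  with inner(1) show ?case by (auto simp: ppoint_eq_iff)
next
  case (types F x y z T)
  let ?Q = "\<lambda>x y z :: complex. y\<^sup>2" and ?C = "\<lambda>x y z :: complex. x ^ 3 + y * z\<^sup>2"
  have F: "eval3 F x y z = ?Q x y z ^ 3 + (?C x y z)\<^sup>2" for x y z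
    by (simp add: types(1))
  have t1: "has_singularity_type F (ppoint 0 0 1) (A 17)"
    by (rule torus_type_z[where Q = ?Q and C = ?C and s = fst and m = 6
          and q = "\<lambda>_. 1" and e = "\<lambda>_. 1" and h = "\<lambda>p. snd p - fst p ^ 3"],
        rule F, (rule hol2_intros)+, simp_all, algebra)
  show ?case using types(2) t1 by auto
qed (auto simp: ppoint_eq_iff)

lemma torus_sextic_A2_A14:
  "\<exists>F. torus_type_23 F \<and> singularity_configuration F {#A 2, A 14#} \<and>
    double_cover F \<in> anticanonical_sections \<Delta>\<^sub>1"
proof (rule torus_sextic_witness[where a = "-1" and b = 0 and c = 0 and d = 1 and
      e = 0 and f = 0 and g = 1 and h = 0 and k = "-1" and l = 0 and
      L = "[((0, 1, 0), A 2), ((0, 0, 1), A 14)]"],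
    goal_cases outer inner points types dist mset)
  case (outer x y z w)
  show ?case
  proof (rule ccontr)
    assume "w \<noteq> 0"
    have eqs: "y\<^sup>2 = x * (2 * z - 3 * w)" "4 * x * y = - z * (2 * z - 3 * w)" "2 * x\<^sup>2 = y * (4 * z - 3 * w)"
      using outer(2-4) by algebra+
    have "w = 0" if "y = 0" using eqs(3) outer(1) that by simp
    then have "y \<noteq> 0" "x \<noteq> 0" "2 * z - 3 * w \<noteq> 0" using \<open>w \<noteq> 0\<close> eqs(1) by auto
    have "x * y * (2 * x * y - (2 * z - 3 * w) * (4 * z - 3 * w)) = 0" using eqs(1,3) by algebra
    with \<open>x \<noteq> 0\<close> \<open>y \<noteq> 0\<close> have "2 * x * y = (2 * z - 3 * w) * (4 * z - 3 * w)" by simp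
    with eqs(2) have "(2 * z - 3 * w) * (9 * z - 6 * w) = 0" by algebra
    with \<open>2 * z - 3 * w \<noteq> 0\<close> have z: "9 * z - 6 * w = 0" by simp
    have "w * (6 * w + 5 * y) = 0" using z eqs(3) outer(1) by algebra
    with \<open>w \<noteq> 0\<close> have y: "6 * w + 5 * y = 0" by simp
    have "w * (108 * x + 25 * w) = 0" using z y eqs(2) by algebra
    with \<open>w \<noteq> 0\<close> have x: "108 * x + 25 * w = 0" by simp
    have "w\<^sup>2 = 0" using x y z eqs(1) by algebra
    with \<open>w \<noteq> 0\<close> show False by simp
  qed
next
  case (inner x y z)
  have "x ^ 5 = 0" using inner(2,3) by algebra
  then have "x = 0" by simp
  with inner show ?case by (auto simp: ppoint_eq_iff)
next
  case (types F x y z T)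
  let ?Q = "\<lambda>x y z :: complex. - x\<^sup>2 + y * z" and ?C = "\<lambda>x y z :: complex. x * y\<^sup>2 - x\<^sup>2 * z + y * z\<^sup>2"
  have F: "eval3 F x y z = ?Q x y z ^ 3 + (?C x y z)\<^sup>2" for x y z
    by (simp add: types(1))
  have t1: "has_singularity_type F (ppoint 0 1 0) (A 2)"
    by (rule torus_transversal_type_y[where Q = ?Q and C = ?C], rule F, (rule hol2_intros)+, simp_all)
  have t2: "has_singularity_type F (ppoint 0 0 1) (A 14)"
    by (rule torus_type_z[where Q = ?Q and C = ?C and s = fst and m = 5
          and q = "\<lambda>p. 1 + fst p ^ 3 + fst p * snd p" and e = "\<lambda>_. -1" and h = "\<lambda>_. 1"],
        rule F, (rule hol2_intros)+, simp_all, algebra)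
  show ?case using types(2) t1 t2 by auto
qed (auto simp: ppoint_eq_iff)

lemma torus_sextic_A5_A11:
  "\<exists>F. torus_type_23 F \<and> singularity_configuration F {#A 5, A 11#} \<and>
    double_cover F \<in> anticanonical_sections \<Delta>\<^sub>1"
proof (rule torus_sextic_witness[where a = 0 and b = 1 and c = 0 and d = 0 and
      e = "-1" and f = 0 and g = 1 and h = 0 and k = 0 and l = 0 and
      L = "[((0, 1, 0), A 5), ((0, 0, 1), A 11)]"],
    goal_cases outer inner points types dist mset)
  case (outer x y z w)
  show ?case
  proof (rule ccontr)
    assume "w \<noteq> 0"
    have "w\<^sup>2 * (4 * y - 3 * w) = 0" using outer(1,3,4) by algebra
    with \<open>w \<noteq> 0\<close> have y: "4 * y = 3 * w" by simp
    have "w * (3 * x + 4 * w) = 0" using y outer(1) by algebra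
    with \<open>w \<noteq> 0\<close> have x: "3 * x = - 4 * w" by (auto simp: eq_neg_iff_add_eq_0)
    have "w\<^sup>2 = 0" using x y outer(2) by algebra
    with \<open>w \<noteq> 0\<close> show False by simp
  qed
next
  case (inner x y z)
  have "x ^ 4 = 0" using inner(2,3) by algebra
  then have "x = 0" by simp
  with inner show ?case by (auto simp: ppoint_eq_iff)
next
  case (types F x y z T)
  let ?Q = "\<lambda>x y z :: complex. x * y" and ?C = "\<lambda>x y z :: complex. - (x ^ 3) + x * y\<^sup>2 + y * z\<^sup>2"
  have F: "eval3 F x y z = ?Q x y z ^ 3 + (?C x y z)\<^sup>2" for x y z
    by (simp add: types(1))
  have t1: "has_singularity_type F (ppoint 0 1 0) (A 5)"
    by (rule torus_type_y[where Q = ?Q and C = ?C and s = snd and m = 2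
          and q = "\<lambda>p. 1 - fst p ^ 2" and e = "\<lambda>_. -1" and h = "\<lambda>_. 1"],
        rule F, (rule hol2_intros)+, simp_all, algebra)
  have t2: "has_singularity_type F (ppoint 0 0 1) (A 11)"
    by (rule torus_type_z[where Q = ?Q and C = ?C and s = fst and m = 4
          and q = "\<lambda>p. 1 + fst p * snd p" and e = "\<lambda>_. 1" and h = fst],
        rule F, (rule hol2_intros)+, simp_all, algebra)
  show ?case using types(2) t1 t2 by auto
qed (auto simp: ppoint_eq_iff)

lemma torus_sextic_E6_A11:
  "\<exists>F. torus_type_23 F \<and> singularity_configuration F {#E6, A 11#} \<and>
    double_cover F \<in> anticanonical_sections \<Delta>\<^sub>1"
proof (rule torus_sextic_witness[where a = 0 and b = 1 and c = 0 and d = 0 and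
      e = "-1" and f = 0 and g = 0 and h = 0 and k = 0 and l = 0 and
      L = "[((0, 1, 0), E6), ((0, 0, 1), A 11)]"],
    goal_cases outer inner points types dist mset)
  case (outer x y z w)
  then have "w ^ 6 = 0" by algebra
  then show ?case by simp
next
  case (inner x y z)
  have "x ^ 4 = 0" using inner(2,3) by algebra
  then have "x = 0" by simp
  with inner show ?case by (auto simp: ppoint_eq_iff)
next
  case (types F x y z T)
  let ?Q = "\<lambda>x y z :: complex. x * y" and ?C = "\<lambda>x y z :: complex. - (x ^ 3) + y * z\<^sup>2"
  have F: "eval3 F x y z = ?Q x y z ^ 3 + (?C x y z)\<^sup>2" for x y z
    by (simp add: types(1))
  have t1: "has_singularity_type F (ppoint 0 1 0) E6"
  proof -
    let ?f = "\<lambda>p :: complex \<times> complex. ?Q (fst p) 1 (snd p) ^ 3 + (?C (fst p) 1 (snd p))\<^sup>2"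
    have f: "?f p = (1 - 2 * snd p ^ 2 + fst p ^ 3) * fst p ^ 3 + 1 * snd p ^ 4" for p
      by simp algebra
    have "curve_germ_iso ?f (0, 0) (ade_equation E6) (0, 0)"
      by (rule brieskorn_germ_iso[where u = fst and s = snd and k = 3 and n = 4
            and \<alpha> = "\<lambda>p. 1 - 2 * snd p ^ 2 + fst p ^ 3" and \<beta> = "\<lambda>_. 1"],
          rule hol2_fst, rule hol2_snd, simp, simp, simp, (rule hol2_intros)+, simp,
          rule hol2_const, simp_all add: f[simplified])
    then show ?thesis
      unfolding has_singularity_type_def F case_prod_beta' by auto
  qed
  have t2: "has_singularity_type F (ppoint 0 0 1) (A 11)"
    by (rule torus_type_z[where Q = ?Q and C = ?C and s = fst and m = 4
          and q = "\<lambda>_. 1" and e = "\<lambda>_. 1" and h = fst],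
        rule F, (rule hol2_intros)+, simp_all, algebra)
  show ?case using types(2) t1 t2 by auto
qed (auto simp: ppoint_eq_iff)

lemma torus_sextic_A8_A8:
  "\<exists>F. torus_type_23 F \<and> singularity_configuration F {#A 8, A 8#} \<and>
    double_cover F \<in> anticanonical_sections \<Delta>\<^sub>1"
proof (rule torus_sextic_witness[where a = 0 and b = 0 and c = 0 and d = 1 and
      e = 1 and f = 0 and g = 0 and h = 0 and k = 0 and l = 1 and
      L = "[((0, 1, 0), A 8), ((0, 0, 1), A 8)]"],
    goal_cases outer inner points types dist mset)
  case (outer x y z w)
  show ?case
  proof (rule ccontr)
    assume "w \<noteq> 0"
    have "x\<^sup>2 = 0" using outer(2) by algebra
    then have "x = 0" by simp
    have "w\<^sup>2 * (y - z) = 0" using outer(1,3,4) \<open>x = 0\<close> by algebra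
    with \<open>w \<noteq> 0\<close> have z: "z = y" by simp
    have "w\<^sup>2 * (2 * y - w) = 0" using outer(1,3) z \<open>x = 0\<close> by algebra
    with \<open>w \<noteq> 0\<close> have w: "w = 2 * y" by simp
    with z outer(1) have "y\<^sup>2 = - (2 * y)\<^sup>2" by (simp add: power2_eq_square)
    then have "y\<^sup>2 = 0" by algebra
    with w \<open>w \<noteq> 0\<close> show False by simp
  qed
next
  case (inner x y z)
  then have yz: "y * z = 0" by simp
  have "x ^ 3 = 0" using inner(3) yz by algebra
  with inner(1) yz show ?case by (auto simp: ppoint_eq_iff)
next
  case (types F x y z T)
  let ?Q = "\<lambda>x y z :: complex. y * z" and ?C = "\<lambda>x y z :: complex. x ^ 3 + y\<^sup>2 * z + y * z\<^sup>2"
  have F: "eval3 F x y z = ?Q x y z ^ 3 + (?C x y z)\<^sup>2" for x y z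
    by (simp add: types(1))
  have t1: "has_singularity_type F (ppoint 0 1 0) (A 8)"
    by (rule torus_type_y[where Q = ?Q and C = ?C and s = fst and m = 3
          and q = "\<lambda>p. 1 + snd p" and e = "\<lambda>_. -1" and h = "\<lambda>_. 1"],
        rule F, (rule hol2_intros)+, simp_all, algebra)
  have t2: "has_singularity_type F (ppoint 0 0 1) (A 8)"
    by (rule torus_type_z[where Q = ?Q and C = ?C and s = fst and m = 3
          and q = "\<lambda>p. 1 + snd p" and e = "\<lambda>_. -1" and h = "\<lambda>_. 1"],
        rule F, (rule hol2_intros)+, simp_all, algebra)
  show ?case using types(2) t1 t2 by auto
qed (auto simp: ppoint_eq_iff)

lemma torus_sextic_A2_A2_A11:
  "\<exists>F. torus_type_23 F \<and> singularity_configuration F {#A 2, A 2, A 11#} \<and>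
    double_cover F \<in> anticanonical_sections \<Delta>\<^sub>1"
proof (rule torus_sextic_witness[where a = 0 and b = 1 and c = 0 and d = 0 and
      e = "-1" and f = 0 and g = 0 and h = "-1" and k = 0 and l = 0 and
      L = "[((0, 1, 1), A 2), ((0, -1, 1), A 2), ((0, 0, 1), A 11)]"],
    goal_cases outer inner points types dist mset)
  case (outer x y z w)
  then have "2 * x ^ 3 = w ^ 3" "2 * y ^ 3 = w ^ 3" "(x * y) ^ 3 = - (w ^ 6)" by algebra+
  then have "w ^ 6 = 0" by algebra
  then show ?case by simp
next
  case (inner x y z)
  have "x ^ 4 = 0" using inner(2,3) by algebra
  then have x: "x = 0" by simp
  have "y * ((z - y) * (z + y)) = 0" using inner(3) x by algebra
  then have "y = 0 \<or> z = y \<or> z = - y" by (auto simp: eq_neg_iff_add_eq_0)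
  with inner(1) x show ?case by (auto simp: ppoint_eq_iff)
next
  case (types F x y z T)
  let ?Q = "\<lambda>x y z :: complex. x * y" and ?C = "\<lambda>x y z :: complex. - (x ^ 3) - y ^ 3 + y * z\<^sup>2"
  have F: "eval3 F x y z = ?Q x y z ^ 3 + (?C x y z)\<^sup>2" for x y z
    by (simp add: types(1))
  have t1: "has_singularity_type F (ppoint 0 1 1) (A 2)"
    by (rule torus_transversal_type_z[where Q = ?Q and C = ?C], rule F, (rule hol2_intros)+, simp_all)
  have t2: "has_singularity_type F (ppoint 0 (-1) 1) (A 2)"
    by (rule torus_transversal_type_z[where Q = ?Q and C = ?C], rule F, (rule hol2_intros)+, simp_all)
  have t3: "has_singularity_type F (ppoint 0 0 1) (A 11)"
    by (rule torus_type_z[where Q = ?Q and C = ?C and s = fst and m = 4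
          and q = "\<lambda>p. 1 - snd p ^ 2" and e = "\<lambda>_. 1" and h = fst],
        rule F, (rule hol2_intros)+, simp_all, algebra)
  show ?case using types(2) t1 t2 t3 by auto
qed (auto simp: ppoint_eq_iff)

lemma torus_sextic_A2_A5_A8:
  "\<exists>F. torus_type_23 F \<and> singularity_configuration F {#A 2, A 5, A 8#} \<and>
    double_cover F \<in> anticanonical_sections \<Delta>\<^sub>1"
proof (rule torus_sextic_witness[where a = 0 and b = 0 and c = 0 and d = 1 and
      e = 1 and f = 1 and g = 0 and h = 0 and k = 0 and l = 1 and
      L = "[((-1, 1, 0), A 2), ((0, 1, 0), A 5), ((0, 0, 1), A 8)]"],
    goal_cases outer inner points types dist mset)
  case (outer x y z w)
  show ?case
  proof (rule ccontr)
    assume "w \<noteq> 0"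
    then have "y \<noteq> 0" using outer(1) by auto
    have "y * (3 * w - 2 * y - 4 * z) = 0" using outer(4) by algebra
    with \<open>y \<noteq> 0\<close> have w: "3 * w - 2 * y - 4 * z = 0" by simp
    have "x * (3 * x + 2 * y) = 0" using outer(2) by algebra
    then consider "x = 0" | "3 * x + 2 * y = 0" by auto
    then show False
    proof cases
      case 1
      have "w\<^sup>2 * (y - z) = 0" using outer(1,3) w 1 by algebra
      with \<open>w \<noteq> 0\<close> have "z = y" by simp
      with w outer(1) have "y\<^sup>2 = 0" by algebra
      with \<open>y \<noteq> 0\<close> show False by simp
    next
      case 2
      have "(3 * z - 4 * y) * (3 * z + y) = 0" using outer(3) w 2 by algebra
      then have "3 * z - 4 * y = 0 \<or> 3 * z + y = 0" by simp
      then have "y\<^sup>2 = 0" using w outer(1) by algebra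
      with \<open>y \<noteq> 0\<close> show False by simp
    qed
  qed
next
  case (inner x y z)
  then have yz: "y * z = 0" by simp
  have "x\<^sup>2 * (x + y) = 0" using inner(3) yz by algebra
  then have "x = 0 \<or> x = - y" by (auto simp: eq_neg_iff_add_eq_0)
  with inner(1) yz show ?case by (auto simp: ppoint_eq_iff)
next
  case (types F x y z T)
  let ?Q = "\<lambda>x y z :: complex. y * z" and ?C = "\<lambda>x y z :: complex. x ^ 3 + x\<^sup>2 * y + y\<^sup>2 * z + y * z\<^sup>2"
  have F: "eval3 F x y z = ?Q x y z ^ 3 + (?C x y z)\<^sup>2" for x y z
    by (simp add: types(1))
  have t1: "has_singularity_type F (ppoint (-1) 1 0) (A 2)"
    by (rule torus_transversal_type_y[where Q = ?Q and C = ?C], rule F, (rule hol2_intros)+, simp_all)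
  have t2: "has_singularity_type F (ppoint 0 1 0) (A 5)"
    by (rule torus_type_y[where Q = ?Q and C = ?C and s = fst and m = 2
          and q = "\<lambda>p. 1 + snd p" and e = "\<lambda>p. - 1 - fst p" and h = "\<lambda>_. 1"],
        rule F, (rule hol2_intros)+, simp_all, algebra)
  have t3: "has_singularity_type F (ppoint 0 0 1) (A 8)"
    by (rule torus_type_z[where Q = ?Q and C = ?C and s = fst and m = 3
          and q = "\<lambda>p. 1 + snd p + fst p ^ 2" and e = "\<lambda>_. -1" and h = "\<lambda>_. 1"],
        rule F, (rule hol2_intros)+, simp_all, algebra)
  show ?case using types(2) t1 t2 t3 by auto
qed (auto simp: ppoint_eq_iff)

lemma torus_sextic_A5_A5_A5:
  "\<exists>F. torus_type_23 F \<and> singularity_configuration F {#A 5, A 5, A 5#} \<and>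
    double_cover F \<in> anticanonical_sections \<Delta>\<^sub>1"
proof (rule torus_sextic_witness[where a = 1 and b = 0 and c = 0 and d = 0 and
      e = 0 and f = 0 and g = 0 and h = "-1" and k = 0 and l = 0 and
      L = "[((0, 0, 1), A 5), ((0, 1, 1), A 5), ((0, -1, 1), A 5)]"],
    goal_cases outer inner points types dist mset)
  case (outer x y z w)
  then have "w ^ 4 = 0" by algebra
  then show ?case by simp
next
  case (inner x y z)
  then have x: "x = 0" by simp
  have "y * ((z - y) * (z + y)) = 0" using inner(3) x by algebra
  then have "y = 0 \<or> z = y \<or> z = - y" by (auto simp: eq_neg_iff_add_eq_0)
  with inner(1) x show ?case by (auto simp: ppoint_eq_iff)
next
  case (types F x y z T)
  let ?Q = "\<lambda>x y z :: complex. x\<^sup>2" and ?C = "\<lambda>x y z :: complex. - (y ^ 3) + y * z\<^sup>2"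
  have F: "eval3 F x y z = ?Q x y z ^ 3 + (?C x y z)\<^sup>2" for x y z
    by (simp add: types(1))
  have A5: "has_singularity_type F (ppoint 0 t 1) (A 5)" if "t \<in> {0, 1, -1}" for t
    by (rule torus_type_z[where Q = ?Q and C = ?C and s = fst and m = 2
          and q = "\<lambda>_. 1" and e = "\<lambda>_. 1" and h = "\<lambda>_. 0"],
        rule F, (rule hol2_intros)+) (use that in auto)
  show ?case using types(2) A5 by auto
qed (auto simp: ppoint_eq_iff)

lemma torus_sextic_A2_A2_A2_A8:
  "\<exists>F. torus_type_23 F \<and> singularity_configuration F {#A 2, A 2, A 2, A 8#} \<and>
    double_cover F \<in> anticanonical_sections \<Delta>\<^sub>1"
proof (rule torus_sextic_witness[where a = 0 and b = 0 and c = 0 and d = 1 and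
      e = 1 and f = 0 and g = "-1" and h = 0 and k = 0 and l = 0 and
      L = "[((0, 1, 0), A 2), ((1, 1, 0), A 2), ((-1, 1, 0), A 2), ((0, 0, 1), A 8)]"],
    goal_cases outer inner points types dist mset)
  case (outer x y z w)
  show ?case
  proof (rule ccontr)
    assume "w \<noteq> 0"
    then have "y \<noteq> 0" using outer(1) by auto
    have "y * (4 * z - 3 * w) = 0" using outer(4) by algebra
    with \<open>y \<noteq> 0\<close> have z: "4 * z = 3 * w" by simp
    have "w * (3 * y + 4 * w) = 0" using z outer(1) by algebra
    with \<open>w \<noteq> 0\<close> have y: "3 * y = - 4 * w" by (auto simp: eq_neg_iff_add_eq_0)
    have "w * (27 * w - 128 * x) = 0" using y z outer(3) by algebra
    with \<open>w \<noteq> 0\<close> have x: "128 * x = 27 * w" by simp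
    have "w\<^sup>2 = 0" using x y outer(2) by algebra
    with \<open>w \<noteq> 0\<close> show False by simp
  qed
next
  case (inner x y z)
  then have yz: "y * z = 0" by simp
  have "x * ((x - y) * (x + y)) = 0" using inner(3) yz by algebra
  then have "x = 0 \<or> x = y \<or> x = - y" by (auto simp: eq_neg_iff_add_eq_0)
  with inner(1) yz show ?case by (auto simp: ppoint_eq_iff)
next
  case (types F x y z T)
  let ?Q = "\<lambda>x y z :: complex. y * z" and ?C = "\<lambda>x y z :: complex. x ^ 3 - x * y\<^sup>2 + y * z\<^sup>2"
  have F: "eval3 F x y z = ?Q x y z ^ 3 + (?C x y z)\<^sup>2" for x y z
    by (simp add: types(1))
  have t1: "has_singularity_type F (ppoint 0 1 0) (A 2)"
    by (rule torus_transversal_type_y[where Q = ?Q and C = ?C], rule F, (rule hol2_intros)+, simp_all)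
  have t2: "has_singularity_type F (ppoint 1 1 0) (A 2)"
    by (rule torus_transversal_type_y[where Q = ?Q and C = ?C], rule F, (rule hol2_intros)+, simp_all)
  have t3: "has_singularity_type F (ppoint (-1) 1 0) (A 2)"
    by (rule torus_transversal_type_y[where Q = ?Q and C = ?C], rule F, (rule hol2_intros)+, simp_all)
  have t4: "has_singularity_type F (ppoint 0 0 1) (A 8)"
    by (rule torus_type_z[where Q = ?Q and C = ?C and s = fst and m = 3
          and q = "\<lambda>p. 1 - fst p * snd p" and e = "\<lambda>_. -1" and h = "\<lambda>_. 1"],
        rule F, (rule hol2_intros)+, simp_all, algebra)
  show ?case using types(2) t1 t2 t3 t4 by auto
qed (auto simp: ppoint_eq_iff)

lemma torus_sextic_A2_A2_A5_A5:
  "\<exists>F. torus_type_23 F \<and> singularity_configuration F {#A 2, A 2, A 5, A 5#} \<and>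
    double_cover F \<in> anticanonical_sections \<Delta>\<^sub>1"
proof (rule torus_sextic_witness[where a = 1 and b = "-1" and c = 0 and d = 0 and
      e = 0 and f = 0 and g = "-1" and h = 0 and k = 0 and l = 0 and
      L = "[((1, 1, 1), A 2), ((-1, -1, 1), A 2), ((0, 0, 1), A 5), ((0, 1, 0), A 5)]"],
    goal_cases outer inner points types dist mset)
  case (outer x y z w)
  show ?case
  proof (rule ccontr)
    assume "w \<noteq> 0"
    then have "x \<noteq> 0" using outer(1) by auto
    with \<open>w \<noteq> 0\<close> have "y \<noteq> 0" using outer(2) by auto
    with outer(4) have "z = 0" by simp
    with outer(3) have "x * (4 * y - 3 * w) = 0" by algebra
    with \<open>x \<noteq> 0\<close> have w: "4 * y = 3 * w" by simp
    have "w * (4 * x - y) = 0" using w outer(2) by algebra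
    with \<open>w \<noteq> 0\<close> have "4 * x = y" by simp
    with w outer(1) have "w\<^sup>2 = 0" by algebra
    with \<open>w \<noteq> 0\<close> show False by simp
  qed
next
  case (inner x y z)
  have "x * (x - y) = 0" "y * (z\<^sup>2 - x * y) = 0" using inner(2,3) by algebra+
  then have "x = 0 \<or> x = y" "y = 0 \<or> z\<^sup>2 = x * y" by auto
  then have "x = 0 \<and> y = 0 \<or> x = 0 \<and> z = 0 \<or> x = y \<and> (z - y) * (z + y) = 0"
    by (auto simp: algebra_simps power2_eq_square)
  then have "x = 0 \<and> y = 0 \<or> x = 0 \<and> z = 0 \<or> x = y \<and> (z = y \<or> z = - y)"
    by (auto simp: eq_neg_iff_add_eq_0)
  with inner(1) show ?case by (auto simp: ppoint_eq_iff)
next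
  case (types F x y z T)
  let ?Q = "\<lambda>x y z :: complex. x\<^sup>2 - x * y" and ?C = "\<lambda>x y z :: complex. - x * y\<^sup>2 + y * z\<^sup>2"
  have F: "eval3 F x y z = ?Q x y z ^ 3 + (?C x y z)\<^sup>2" for x y z
    by (simp add: types(1))
  have t1: "has_singularity_type F (ppoint 1 1 1) (A 2)"
    by (rule torus_transversal_type_z[where Q = ?Q and C = ?C], rule F, (rule hol2_intros)+, simp_all)
  have t2: "has_singularity_type F (ppoint (-1) (-1) 1) (A 2)"
    by (rule torus_transversal_type_z[where Q = ?Q and C = ?C], rule F, (rule hol2_intros)+, simp_all)
  have t3: "has_singularity_type F (ppoint 0 0 1) (A 5)"
    by (rule torus_type_z[where Q = ?Q and C = ?C and s = fst and m = 2
          and q = "\<lambda>p. 1 - fst p * snd p" and e = "\<lambda>p. 1 - fst p * snd p" and h = "\<lambda>p. - fst p"],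
        rule F, (rule hol2_intros)+, simp_all, algebra)
  have t4: "has_singularity_type F (ppoint 0 1 0) (A 5)"
    by (rule torus_type_y[where Q = ?Q and C = ?C and s = snd and m = 2
          and q = "\<lambda>_. 1" and e = "\<lambda>p. fst p - 1" and h = "\<lambda>p. 1 - fst p"],
        rule F, (rule hol2_intros)+, simp_all, algebra)
  show ?case using types(2) t1 t2 t3 t4 by auto
qed (auto simp: ppoint_eq_iff)

lemma torus_sextic_A2_A2_A2_A2_A5:
  "\<exists>F. torus_type_23 F \<and> singularity_configuration F {#A 2, A 2, A 2, A 2, A 5#} \<and>
    double_cover F \<in> anticanonical_sections \<Delta>\<^sub>1"
proof (rule torus_sextic_witness[where a = "-1" and b = 0 and c = 1 and d = 0 and
      e = 0 and f = 0 and g = 0 and h = "-1" and k = 0 and l = 0 and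
      L = "[((1, 1, 1), A 2), ((-1, -1, 1), A 2), ((1, -1, 1), A 2), ((-1, 1, 1), A 2), ((0, 0, 1), A 5)]"],
    goal_cases outer inner points types dist mset)
  case (outer x y z w)
  show ?case
  proof (rule ccontr)
    assume "w \<noteq> 0"
    with outer(2) have x: "x = 0" by simp
    with \<open>w \<noteq> 0\<close> have "y \<noteq> 0" using outer(1) by auto
    with outer(4) have "z = 0" by simp
    with outer(3) have "y * (y + w) = 0" by algebra
    with \<open>y \<noteq> 0\<close> have "y = - w" by (simp add: eq_neg_iff_add_eq_0)
    with x outer(1) have "w\<^sup>2 = 0" by algebra
    with \<open>w \<noteq> 0\<close> show False by simp
  qed
next
  case (inner x y z)
  have "(x - y) * (x + y) = 0" "y * ((z - y) * (z + y)) = 0" using inner(2,3) by algebra+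
  then have "x = y \<or> x = - y" "y = 0 \<or> z = y \<or> z = - y"
    by (auto simp: eq_neg_iff_add_eq_0)
  with inner(1) show ?case by (auto simp: ppoint_eq_iff)
next
  case (types F x y z T)
  let ?Q = "\<lambda>x y z :: complex. - x\<^sup>2 + y\<^sup>2" and ?C = "\<lambda>x y z :: complex. - (y ^ 3) + y * z\<^sup>2"
  have F: "eval3 F x y z = ?Q x y z ^ 3 + (?C x y z)\<^sup>2" for x y z
    by (simp add: types(1))
  have t1: "has_singularity_type F (ppoint 1 1 1) (A 2)"
    by (rule torus_transversal_type_z[where Q = ?Q and C = ?C], rule F, (rule hol2_intros)+, simp_all)
  have t2: "has_singularity_type F (ppoint (-1) (-1) 1) (A 2)"
    by (rule torus_transversal_type_z[where Q = ?Q and C = ?C], rule F, (rule hol2_intros)+, simp_all)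
  have t3: "has_singularity_type F (ppoint 1 (-1) 1) (A 2)"
    by (rule torus_transversal_type_z[where Q = ?Q and C = ?C], rule F, (rule hol2_intros)+, simp_all)
  have t4: "has_singularity_type F (ppoint (-1) 1 1) (A 2)"
    by (rule torus_transversal_type_z[where Q = ?Q and C = ?C], rule F, (rule hol2_intros)+, simp_all)
  have t5: "has_singularity_type F (ppoint 0 0 1) (A 5)"
    by (rule torus_type_z[where Q = ?Q and C = ?C and s = fst and m = 2
          and q = "\<lambda>p. 1 - snd p ^ 2" and e = "\<lambda>p. snd p ^ 2 - 1" and h = snd],
        rule F, (rule hol2_intros)+, simp_all, algebra)
  show ?case using types(2) t1 t2 t3 t4 t5 by auto
qed (auto simp: ppoint_eq_iff)

theorem proposition4p1:
  "\<forall>M \<in> {{#A 17#}, {#A 2, A 14#}, {#A 5, A 11#}, {#E6, A 11#}, {#A 8, A 8#},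
         {#A 2, A 2, A 11#}, {#A 2, A 5, A 8#}, {#A 5, A 5, A 5#}, {#A 2, A 2, A 2, A 8#},
         {#A 2, A 2, A 5, A 5#}, {#A 2, A 2, A 2, A 2, A 5#}}.
     \<exists>F. torus_type_23 F \<and> singularity_configuration F M \<and>
         double_cover F \<in> anticanonical_sections \<Delta>\<^sub>1"
  using torus_sextic_A17 torus_sextic_A2_A14 torus_sextic_A5_A11 torus_sextic_E6_A11
    torus_sextic_A8_A8 torus_sextic_A2_A2_A11 torus_sextic_A2_A5_A8 torus_sextic_A5_A5_A5
    torus_sextic_A2_A2_A2_A8 torus_sextic_A2_A2_A5_A5 torus_sextic_A2_A2_A2_A2_A5
  by simp

end
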